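(* The following statements hold. (i) For any positive integer $k$, $r'_2(K_{2,3\cdot 4^{k-1}-1})=CR(K_{2,3\cdot 4^{k-1}-1},K_3)=4^{k}$. (ii) For any odd prime power $q$, $r'_2\big(K_{2,\frac{3q^2+1}{4}}\big)=CR\big(K_{2,\frac{3q^2+1}{4}},K_3\big)=q^2+2$.
   Context: An edge-colored graph $G$ on $p$ vertices with edge-coloring $\chi$ is called orderable if there exist an ordering $(v_1,\ldots,v_p)$ of $V(G)$ and a list $(c_1,\ldots,c_{p-1})$ of not necessarily distinct colors such that for every edge $v_iv_j\in E(G)$ with $i<j$ we have $\chi(v_iv_j)=c_i$. An edge-colored graph is rainbow if all its edges have pairwise different colors. For a graph $G$, $r'_2(G)$ is the minimum integer $n$ such that every 2-edge-coloring of $K_n$ (each edge gets one of two given colors) contains an orderable copy of $G$. For graphs $G,H$, $CR(G,H)$ is the minimum integer $n$ such that every edge-coloring of $K_n$ with any number of colors contains either an orderable copy of $G$ or a rainbow copy of $H$. Copies are (not necessarily induced) subgraphs with the inherited coloring. *)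

theory Defs
  imports "HOL-Library.Ramsey" "HOL-Library.FuncSet" "HOL-Number_Theory.Prime_Powers"
begin

record 'v graph =
  verts :: "'v set"
  edges :: "'v set set"

definition simple_graph :: "'v graph \<Rightarrow> bool" where
  "simple_graph G \<longleftrightarrow> finite (verts G) \<and> edges G \<subseteq> nsets (verts G) 2"

definition subgraph_of :: "'v graph \<Rightarrow> 'v graph \<Rightarrow> bool" where
  "subgraph_of H G \<longleftrightarrow>
     simple_graph H \<and> simple_graph G \<and> verts H \<subseteq> verts G \<and> edges H \<subseteq> edges G"

definition isomorphic :: "'v graph \<Rightarrow> 'w graph \<Rightarrow> bool" where
  "isomorphic G H \<longleftrightarrow>
     (\<exists>\<phi>. bij_betw \<phi> (verts G) (verts H) \<and> edges H = image \<phi> ` edges G)"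

definition complete_graph :: "nat \<Rightarrow> nat graph" where
  "complete_graph n = \<lparr> verts = {..<n}, edges = nsets {..<n} 2 \<rparr>"

definition complete_bipartite :: "nat \<Rightarrow> nat \<Rightarrow> (nat + nat) graph" where
  "complete_bipartite s t =
     \<lparr> verts = {..<s} <+> {..<t}, edges = {{Inl i, Inr j} | i j. i < s \<and> j < t} \<rparr>"

text \<open>
  A coloring is a function on all vertex sets, of which only the values on edges matter; the
  coloring inherited by a subgraph is therefore the same function. In \<open>orderable\<close> the list
  \<open>vs\<close> is the ordering of the vertices and \<open>cs\<close> the list of colors, both indexed from 0.
\<close>

definition orderable :: "'v graph \<Rightarrow> ('v set \<Rightarrow> 'c) \<Rightarrow> bool" where
  "orderable G \<chi> \<longleftrightarrow>
     (\<exists>vs cs. distinct vs \<and> set vs = verts G \<and> length cs = card (verts G) - 1 \<and>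
        (\<forall>i j. i < j \<longrightarrow> j < length vs \<longrightarrow> {vs ! i, vs ! j} \<in> edges G \<longrightarrow>
               \<chi> {vs ! i, vs ! j} = cs ! i))"

definition rainbow :: "'v graph \<Rightarrow> ('v set \<Rightarrow> 'c) \<Rightarrow> bool" where
  "rainbow G \<chi> \<longleftrightarrow> inj_on \<chi> (edges G)"

definition has_orderable_copy :: "'v graph \<Rightarrow> 'w graph \<Rightarrow> ('w set \<Rightarrow> 'c) \<Rightarrow> bool" where
  "has_orderable_copy G K \<chi> \<longleftrightarrow>
     (\<exists>H. subgraph_of H K \<and> isomorphic G H \<and> orderable H \<chi>)"

definition has_rainbow_copy :: "'v graph \<Rightarrow> 'w graph \<Rightarrow> ('w set \<Rightarrow> 'c) \<Rightarrow> bool" where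
  "has_rainbow_copy G K \<chi> \<longleftrightarrow>
     (\<exists>H. subgraph_of H K \<and> isomorphic G H \<and> rainbow H \<chi>)"

text \<open>
  For natural numbers \<open>Inf\<close> of a nonempty set is its minimum, and \<open>Inf {} = 0\<close>. Hence an
  equation stating a positive value includes the claim that the minimum exists.
  Natural numbers suffice as colors, since a coloring of a complete graph on finitely many
  vertices uses only finitely many of them.
\<close>

definition orderable_ramsey2 :: "'v graph \<Rightarrow> nat" where
  "orderable_ramsey2 G =
     Inf {n. \<forall>\<chi> :: nat set \<Rightarrow> nat. \<chi> \<in> edges (complete_graph n) \<rightarrow> {0, 1} \<longrightarrow>
               has_orderable_copy G (complete_graph n) \<chi>}"

definition CR :: "'v graph \<Rightarrow> 'w graph \<Rightarrow> nat" where
  "CR G H =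
     Inf {n. \<forall>\<chi> :: nat set \<Rightarrow> nat.
               has_orderable_copy G (complete_graph n) \<chi> \<or>
               has_rainbow_copy H (complete_graph n) \<chi>}"

end

theory Submission
  imports "HOL-Algebra.Algebraic_Closure" "HOL-Number_Theory.Residues" Defs
begin

text \<open>
  An orderable copy of \<open>K(2,t)\<close> is a pair of vertices \<open>a\<close>, \<open>b\<close> with a color \<open>\<alpha>\<close> and \<open>t\<close> leaves \<open>w\<close>
  such that \<open>wa\<close> has the color of \<open>wb\<close> or the color \<open>\<alpha>\<close>.

  Upper bound: choose \<open>\<alpha>\<close> to be the color of \<open>ab\<close>. Without rainbow triangles some pair then has fewer
  than \<open>n/4\<close> bad leaves. If three colors occur, one of them spans a disconnected graph (Gallai), and
  a component of it is a homogeneous set to which one can pass, because vertices outside are never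
  bad for pairs inside. If at most two colors occur, double count the leaves that see the two
  vertices of a pair in different colors.

  Lower bound: a 2-coloring in which each ordered pair has many leaves of type (0,1). For \<open>4^k\<close> take
  the symplectic matrix over \<open>GF(2)\<close> without its row 0; for \<open>q^2 + 2\<close> take a symmetric conference
  matrix of order \<open>q^2 + 1\<close> with constant row sum, obtained from an affine plane of order \<open>q\<close> by giving
  the sign 1 to half of its parallel classes, bordering, and switching at \<open>(q-1)/2\<close> parallel lines.
\<close>

section \<open>Colorings without rainbow triangles\<close>

definition gallai :: "('v set \<Rightarrow> 'c) \<Rightarrow> 'v set \<Rightarrow> bool" where
  "gallai c V \<longleftrightarrow> (\<forall>u\<in>V. \<forall>v\<in>V. \<forall>w\<in>V. u \<noteq> v \<longrightarrow> u \<noteq> w \<longrightarrow> v \<noteq> w \<longrightarrow>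
     c {u, v} = c {u, w} \<or> c {u, v} = c {v, w} \<or> c {u, w} = c {v, w})"

definition color_rel :: "('v set \<Rightarrow> 'c) \<Rightarrow> 'c \<Rightarrow> 'v set \<Rightarrow> ('v \<times> 'v) set" where
  "color_rel c i V = {(u, v). u \<in> V \<and> v \<in> V \<and> u \<noteq> v \<and> c {u, v} = i}"

lemma gallaiD:
  assumes "gallai c V" "u \<in> V" "v \<in> V" "w \<in> V" "u \<noteq> v" "u \<noteq> w" "v \<noteq> w"
  shows "c {u, v} = c {u, w} \<or> c {u, v} = c {v, w} \<or> c {u, w} = c {v, w}"
  using assms(1)[unfolded gallai_def, rule_format, OF assms(2-4)] assms(5-7) by simp

lemma gallai_subset: "gallai c V \<Longrightarrow> W \<subseteq> V \<Longrightarrow> gallai c W"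
  unfolding gallai_def by blast

lemma color_rel_rtrancl_sym:
  "(u, v) \<in> (color_rel c i V)\<^sup>* \<Longrightarrow> (v, u) \<in> (color_rel c i V)\<^sup>*"
proof -
  have "sym (color_rel c i V)"
    by (auto simp: sym_def color_rel_def insert_commute)
  then show "(u, v) \<in> (color_rel c i V)\<^sup>* \<Longrightarrow> (v, u) \<in> (color_rel c i V)\<^sup>*"
    using sym_rtrancl symD by metis
qed

text \<open>Along an edge \<open>yz\<close> of color \<open>i\<close> in the component, the outside
  vertex \<open>w\<close> sends no edge of color \<open>i\<close> to \<open>y\<close> or
  \<open>z\<close>, so the triangle \<open>wyz\<close> avoids being rainbow only if
  \<open>wy\<close> and \<open>wz\<close> agree.\<close>

lemma component_homogeneous:
  assumes "gallai c V" "w \<in> V" "(a, w) \<notin> (color_rel c i V)\<^sup>*"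
    and "(a, b) \<in> (color_rel c i V)\<^sup>*"
  shows "c {w, a} = c {w, b}"
  using assms(4)
proof (induction rule: rtrancl_induct)
  case base
  show ?case by simp
next
  case (step y z)
  have yz: "y \<in> V" "z \<in> V" "y \<noteq> z" "c {y, z} = i"
    using step.hyps(2) by (auto simp: color_rel_def)
  have "(y, w) \<notin> (color_rel c i V)\<^sup>*" "(z, w) \<notin> (color_rel c i V)\<^sup>*"
    using step.hyps assms(3) by (meson rtrancl_trans rtrancl.rtrancl_into_rtrancl)+
  then have "(y, w) \<notin> color_rel c i V" "(z, w) \<notin> color_rel c i V" "y \<noteq> w" "z \<noteq> w"
    by auto
  then have "c {y, w} \<noteq> i" "c {z, w} \<noteq> i"
    using yz assms(2) by (auto simp: color_rel_def)
  with gallaiD[OF assms(1), of y z w] yz assms(2) \<open>y \<noteq> w\<close> \<open>z \<noteq> w\<close>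
  have "c {y, w} = c {z, w}" by auto
  then show ?case using step.IH by (simp add: insert_commute)
qed

lemma color_connected_neighbor:
  assumes "v \<in> V" "u \<in> V" "u \<noteq> v" "(v, u) \<in> (color_rel c i V)\<^sup>*"
  obtains x where "x \<in> V - {v}" "c {v, x} = i"
proof -
  obtain x where "(v, x) \<in> color_rel c i V"
    using assms(3,4) by (metis converse_rtranclE)
  then show ?thesis using that unfolding color_rel_def by blast
qed

text \<open>On a path of color \<open>i\<close> from \<open>u\<close> to \<open>v\<close>, the
  vertex just before the first visit to \<open>v\<close> serves as \<open>w\<close>.\<close>

lemma color_connected_delete:
  assumes "(u, v) \<in> (color_rel c i V)\<^sup>*" "u \<noteq> v"
  shows "\<exists>w \<in> V - {v}. (u, w) \<in> (color_rel c i (V - {v}))\<^sup>* \<and> c {v, w} = i"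
  using assms
proof (induction rule: converse_rtrancl_induct)
  case base
  then show ?case by simp
next
  case (step y z)
  have yz: "y \<in> V" "z \<in> V" "y \<noteq> z" "c {y, z} = i"
    using step.hyps(1) by (auto simp: color_rel_def)
  show ?case
  proof (cases "z = v")
    case True
    then show ?thesis using yz by (auto simp: insert_commute intro!: bexI[of _ y])
  next
    case False
    then obtain w where w: "w \<in> V - {v}" "(z, w) \<in> (color_rel c i (V - {v}))\<^sup>*" "c {v, w} = i"
      using step.IH by blast
    have "(y, z) \<in> color_rel c i (V - {v})"
      using yz False step.prems by (auto simp: color_rel_def)
    with w(2) have "(y, w) \<in> (color_rel c i (V - {v}))\<^sup>*" 
      using converse_rtrancl_into_rtrancl by metis
    with w show ?thesis by blast
  qed
qed

text \<open>
  The vertex \<open>v\<close> sends an edge of color \<open>i\<close> to each color-\<open>i\<close> component of the rest, and any two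
  components are joined monochromatically. The edges \<open>vx\<close> and \<open>vy\<close> would dictate both \<open>j\<close> and \<open>k\<close>
  as that joining color.
\<close>

lemma three_colors_connected_aux:
  assumes g: "gallai c V" and v: "v \<in> V" and ne: "i \<noteq> j" "i \<noteq> k" "j \<noteq> k"
    and conn: "\<And>u. u \<in> V \<Longrightarrow> (u, v) \<in> (color_rel c i V)\<^sup>*"
    and x: "x \<in> V - {v}" "c {v, x} = j" and y: "y \<in> V - {v}" "c {v, y} = k"
    and p: "p \<in> V - {v}" "r \<in> V - {v}" "(p, r) \<notin> (color_rel c i (V - {v}))\<^sup>*"
  shows False
proof -
  let ?R = "(color_rel c i (V - {v}))\<^sup>*"
  have g': "gallai c (V - {v})" using g by (rule gallai_subset) auto
  have nb: "\<exists>w \<in> V - {v}. (u, w) \<in> ?R \<and> c {v, w} = i" if "u \<in> V - {v}" for u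
    using color_connected_delete[OF conn, of u] that by auto
  have tri: "c {a, b} = l" if "a \<in> V - {v}" "b \<in> V - {v}" "(a, b) \<notin> ?R" "c {v, a} = l"
    "c {v, b} = i" "l \<noteq> i" for a b l
  proof -
    have "a \<noteq> b" using that by auto
    moreover have "c {a, b} \<noteq> i" using that \<open>a \<noteq> b\<close> by (auto simp: color_rel_def)
    ultimately show ?thesis using gallaiD[OF g, of v a b] v that by auto
  qed
  \<comment> \<open>The vertices \<open>p\<close> and \<open>r\<close> cannot both lie in the
    component of \<open>x\<close>, so one of them can serve as \<open>z\<close>.\<close>
  obtain z where z: "z \<in> V - {v}" "(x, z) \<notin> ?R"
    using p by (meson color_rel_rtrancl_sym rtrancl_trans)
  obtain z' where z': "z' \<in> V - {v}" "(z, z') \<in> ?R" "c {v, z'} = i" using nb z by blast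
  have xz': "(x, z') \<notin> ?R" using z z' by (meson color_rel_rtrancl_sym rtrancl_trans)
  have cx: "c {x, z'} = j" using tri[OF x(1) z'(1) xz' x(2) z'(3)] ne by auto
  show False
  proof (cases "(x, y) \<in> ?R")
    case True
    have "c {z', x} = c {z', y}"
      using component_homogeneous[OF g' z'(1) xz' True] .
    moreover have "(y, z') \<notin> ?R" using True xz' by (meson rtrancl_trans)
    then have "c {y, z'} = k" using tri[OF y(1) z'(1) _ y(2) z'(3)] ne by auto
    ultimately show False using cx ne by (simp add: insert_commute)
  next
    case False
    obtain x' where x': "x' \<in> V - {v}" "(x, x') \<in> ?R" "c {v, x'} = i" using nb x by blast
    obtain y' where y': "y' \<in> V - {v}" "(y, y') \<in> ?R" "c {v, y'} = i" using nb y by blast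
    have 1: "(x, y') \<notin> ?R" using False y' by (meson color_rel_rtrancl_sym rtrancl_trans)
    have 2: "(y, x') \<notin> ?R" using False x' by (meson color_rel_rtrancl_sym rtrancl_trans)
    have "c {x, y'} = j" using tri[OF x(1) y'(1) 1 x(2) y'(3)] ne by auto
    moreover have "c {y, x'} = k" using tri[OF y(1) x'(1) 2 y(2) x'(3)] ne by auto
    moreover have "c {y', x} = c {y', x'}" using component_homogeneous[OF g' y'(1) 1 x'(2)] .
    moreover have "c {x', y} = c {x', y'}" using component_homogeneous[OF g' x'(1) 2 y'(2)] .
    ultimately show False using ne by (simp add: insert_commute)
  qed
qed

text \<open>Otherwise all three colors are connected, so a vertex \<open>v\<close> has edges in each
  of them. By induction some color is disconnected after deleting \<open>v\<close>, and
  \<open>three_colors_connected_aux\<close> refutes this, with edges of the other two colors at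
  \<open>v\<close> as \<open>vx\<close> and \<open>vy\<close>.\<close>

lemma gallai_three_colors_disconnected:
  assumes "finite V" "card V \<ge> 2" "gallai c V" "i \<noteq> j" "i \<noteq> k" "j \<noteq> k"
  shows "\<exists>l \<in> {i, j, k}. \<exists>u \<in> V. \<exists>v \<in> V. (u, v) \<notin> (color_rel c l V)\<^sup>*"
  using assms(1-3)
proof (induction "card V" arbitrary: V rule: less_induct)
  case less
  show ?case
  proof (rule ccontr)
    assume "\<not> ?thesis"
    then have conn: "(u, v) \<in> (color_rel c l V)\<^sup>*" if "l \<in> {i, j, k}" "u \<in> V" "v \<in> V" for l u v
      using that by blast
    obtain v u where uv: "v \<in> V" "u \<in> V" "u \<noteq> v"
      using less.prems(1,2) card_le_Suc0_iff_eq[of V] by auto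
    have nb: "\<exists>x \<in> V - {v}. c {v, x} = l" if "l \<in> {i, j, k}" for l
      using color_connected_neighbor[OF uv conn[OF that uv(1,2)]] by blast
    obtain x y z where xyz: "x \<in> V - {v}" "c {v, x} = i" "y \<in> V - {v}" "c {v, y} = j"
      "z \<in> V - {v}" "c {v, z} = k"
      using nb[of i] nb[of j] nb[of k] by auto
    have "x \<noteq> y" using xyz assms by auto
    then have "card {x, y} \<le> card (V - {v})"
      using xyz less.prems(1) by (intro card_mono) auto
    then have "card (V - {v}) \<ge> 2" using \<open>x \<noteq> y\<close> by simp
    moreover have "card (V - {v}) < card V" using uv less.prems(1) by (meson card_Diff1_less)
    moreover have "gallai c (V - {v})" using less.prems(3) by (rule gallai_subset) auto
    ultimately obtain l p r where l: "l \<in> {i, j, k}" "p \<in> V - {v}" "r \<in> V - {v}"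
      "(p, r) \<notin> (color_rel c l (V - {v}))\<^sup>*"
      using less.hyps[of "V - {v}"] less.prems(1) by blast
    note aux = three_colors_connected_aux[OF less.prems(3) uv(1) _ _ _ conn[OF _ _ uv(1)] _ _ _ _
        l(2,3)]
    from l(1) consider "l = i" | "l = j" | "l = k" by blast
    then show False
    proof cases
      case 1
      show False by (rule aux[of i j k y z]) (use xyz l 1 assms(4-6) in auto)
    next
      case 2
      show False by (rule aux[of j i k x z]) (use xyz l 2 assms(4-6) in auto)
    next
      case 3
      show False by (rule aux[of k i j x y]) (use xyz l 3 assms(4-6) in auto)
    qed
  qed
qed

section \<open>Pairs with few bad leaves\<close>

lemma four_mult_le_square: "4 * (a * b) \<le> (a + b)\<^sup>2" for a b :: nat
proof (cases "a \<le> b")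
  case True
  then obtain d where "b = a + d" using le_Suc_ex by blast
  then show ?thesis by (simp add: power2_eq_square algebra_simps)
next
  case False
  then obtain d where "a = b + d" using le_Suc_ex by (metis nat_le_linear)
  then show ?thesis by (simp add: power2_eq_square algebra_simps)
qed

text \<open>
  In the ordering that puts leaves \<open>w\<close> with \<open>c {w, a} = c {w, b}\<close> first, then \<open>a\<close> with list color \<open>\<alpha>\<close>,
  then the other leaves, then \<open>b\<close>, exactly the following leaves violate the condition.
\<close>

definition bad_leaves :: "('v set \<Rightarrow> 'c) \<Rightarrow> 'v set \<Rightarrow> 'c \<Rightarrow> 'v \<Rightarrow> 'v \<Rightarrow> 'v set" where
  "bad_leaves c V \<alpha> a b = {w \<in> V - {a, b}. c {w, a} \<noteq> c {w, b} \<and> c {w, a} \<noteq> \<alpha>}"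

text \<open>If each ordered pair had at least \<open>n/4\<close> bad leaves, every pair would be
  told apart by at least \<open>n/2\<close> leaves, whereas one leaf tells apart at most
  \<open>(n-1)^2/2\<close> ordered pairs. Counting gives \<open>n (n-1) n <= n (n-1)^2\<close>,
  which is false for \<open>n >= 2\<close>.\<close>

lemma two_colors_few_bad_leaves:
  assumes fin: "finite V" and card: "card V \<ge> 2"
    and two: "\<And>u v. u \<in> V \<Longrightarrow> v \<in> V \<Longrightarrow> u \<noteq> v \<Longrightarrow> c {u, v} \<in> {p, r}"
  shows "\<exists>a \<in> V. \<exists>b \<in> V. a \<noteq> b \<and> 4 * card (bad_leaves c V (c {a, b}) a b) < card V"
proof (rule ccontr)
  assume "\<not> ?thesis"
  then have many: "card V \<le> 4 * card (bad_leaves c V (c {a, b}) a b)"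
    if "a \<in> V" "b \<in> V" "a \<noteq> b" for a b
    using that by (meson not_le)
  define D where "D a b = {w \<in> V - {a, b}. c {w, a} \<noteq> c {w, b}}" for a b
  define Q where "Q = {(a, b). a \<in> V \<and> b \<in> V \<and> a \<noteq> b}"
  define n where "n = card V"
  have Q: "Q = (SIGMA a:V. V - {a})" unfolding Q_def by auto
  have cQ: "card Q = n * (n - 1)"
    unfolding Q using fin by (simp add: n_def)
  have finQ: "finite Q" unfolding Q using fin by auto
  have D: "n \<le> 2 * card (D a b)" if ab: "a \<in> V" "b \<in> V" "a \<noteq> b" for a b
  proof -
    \<comment> \<open>With two colors, a leaf that tells \<open>a\<close> and \<open>b\<close> apart
      has exactly one edge not in the color of \<open>ab\<close>, so it is bad for exactly one of
      the two orders of the pair.\<close>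
    have "D a b = bad_leaves c V (c {a, b}) a b \<union> bad_leaves c V (c {b, a}) b a"
    proof -
      have "c {w, a} = c {a, b} \<longrightarrow> c {w, b} \<noteq> c {a, b}" if "w \<in> D a b" for w
        using that unfolding D_def by auto
      then show ?thesis unfolding D_def bad_leaves_def by (auto simp: insert_commute)
    qed
    moreover have "bad_leaves c V (c {a, b}) a b \<inter> bad_leaves c V (c {b, a}) b a = {}"
    proof -
      have False if "w \<in> V" "w \<noteq> a" "w \<noteq> b" "c {w, a} \<noteq> c {w, b}" "c {w, a} \<noteq> c {a, b}"
         "c {w, b} \<noteq> c {a, b}" for w
        using two[of w a] two[of w b] two[of a b] ab that by auto
      then show ?thesis unfolding bad_leaves_def by (auto simp: insert_commute)
    qed
    ultimately have "card (D a b)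
        = card (bad_leaves c V (c {a, b}) a b) + card (bad_leaves c V (c {b, a}) b a)"
      using fin by (simp add: card_Un_disjoint bad_leaves_def)
    then show ?thesis using many[OF ab] many[of b a] ab unfolding n_def by auto
  qed
  have "n * (n * (n - 1)) = (\<Sum>(a, b)\<in>Q. n)" using cQ by (simp add: case_prod_unfold)
  also have "\<dots> \<le> (\<Sum>(a, b)\<in>Q. 2 * card (D a b))"
    by (rule sum_mono) (use D in \<open>auto simp: Q_def\<close>)
  also have "\<dots> = 2 * (\<Sum>q\<in>Q. \<Sum>w | w \<in> V \<and> w \<in> D (fst q) (snd q). 1)"
  proof -
    have "card (D a b) = (\<Sum>w | w \<in> V \<and> w \<in> D a b. 1)" for a b
    proof -
      have "{w. w \<in> V \<and> w \<in> D a b} = D a b" unfolding D_def by auto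
      then show ?thesis by simp
    qed
    then show ?thesis by (simp add: sum_distrib_left case_prod_unfold)
  qed
  also have "\<dots> = 2 * (\<Sum>w\<in>V. \<Sum>q | q \<in> Q \<and> w \<in> D (fst q) (snd q). 1)"
    using sum.swap_restrict[OF finQ fin, of "\<lambda>_ _. 1::nat" "\<lambda>q w. w \<in> D (fst q) (snd q)"]
    by simp
  also have "\<dots> = 2 * (\<Sum>w\<in>V. card {q \<in> Q. w \<in> D (fst q) (snd q)})" by simp
  also have "\<dots> \<le> (\<Sum>w\<in>V. (n - 1)\<^sup>2)"
    unfolding sum_distrib_left
  proof (rule sum_mono)
    fix w assume w: "w \<in> V"
    define A where "A = {a \<in> V - {w}. c {w, a} = p}"
    define B where "B = {a \<in> V - {w}. c {w, a} \<noteq> p}"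
    have "card A + card B = card (A \<union> B)"
      using fin by (subst card_Un_disjoint) (auto simp: A_def B_def)
    also have "A \<union> B = V - {w}" by (auto simp: A_def B_def)
    finally have AB: "card A + card B = n - 1" using w fin by (simp add: n_def)
    \<comment> \<open>The leaf \<open>w\<close> tells apart only pairs with one vertex in
      \<open>A\<close> and the other in \<open>B\<close>.\<close>
    have "{q \<in> Q. w \<in> D (fst q) (snd q)} \<subseteq> A \<times> B \<union> B \<times> A"
    proof -
      have "(a, b) \<in> A \<times> B \<union> B \<times> A"
        if "a \<in> V" "b \<in> V" "w \<noteq> a" "w \<noteq> b" "c {w, a} \<noteq> c {w, b}" for a b
        using two[OF w that(1) that(3)] two[OF w that(2) that(4)] that
        by (auto simp del: insert_commute simp: A_def B_def)
      note in_AB = this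
      show ?thesis
      proof
        fix q assume "q \<in> {q \<in> Q. w \<in> D (fst q) (snd q)}"
        then show "q \<in> A \<times> B \<union> B \<times> A"
          using in_AB[of "fst q" "snd q"] by (auto simp: Q_def D_def)
      qed
    qed
    then have "card {q \<in> Q. w \<in> D (fst q) (snd q)} \<le> card (A \<times> B \<union> B \<times> A)"
      using fin by (intro card_mono) (auto simp: A_def B_def)
    also have "\<dots> \<le> 2 * (card A * card B)"
      using card_Un_le[of "A \<times> B" "B \<times> A"] by (simp add: card_cartesian_product mult.commute)
    finally have "2 * card {q \<in> Q. w \<in> D (fst q) (snd q)} \<le> 4 * (card A * card B)" by simp
    also have "\<dots> \<le> (card A + card B)\<^sup>2"
      by (rule four_mult_le_square)
    finally show "2 * card {q \<in> Q. w \<in> D (fst q) (snd q)} \<le> (n - 1)\<^sup>2" by (simp add: AB)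
  qed
  also have "\<dots> = n * (n - 1)\<^sup>2" by (simp add: n_def)
  finally have "n * ((n - 1) * n) \<le> n * ((n - 1) * (n - 1))"
    by (simp add: power2_eq_square mult.commute)
  then show False using card unfolding n_def by simp
qed

lemma gallai_few_bad_leaves:
  assumes "finite V" "card V \<ge> 2" "gallai c V"
  shows "\<exists>a \<in> V. \<exists>b \<in> V. a \<noteq> b \<and> 4 * card (bad_leaves c V (c {a, b}) a b) < card V"
  using assms
proof (induction "card V" arbitrary: V rule: less_induct)
  case less
  show ?case
  proof (cases "\<exists>p r. \<forall>u \<in> V. \<forall>v \<in> V. u \<noteq> v \<longrightarrow> c {u, v} \<in> {p, r}")
    case True
    then obtain p r where "\<And>u v. u \<in> V \<Longrightarrow> v \<in> V \<Longrightarrow> u \<noteq> v \<Longrightarrow> c {u, v} \<in> {p, r}" by blast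
    then show ?thesis by (rule two_colors_few_bad_leaves[OF less.prems(1,2)])
  next
    case False
    define U where "U = {c {u, v} | u v. u \<in> V \<and> v \<in> V \<and> u \<noteq> v}"
    have many: "\<exists>x \<in> U. x \<notin> {p, r}" for p r
    proof -
      obtain u v where "u \<in> V" "v \<in> V" "u \<noteq> v" "c {u, v} \<notin> {p, r}" using False by meson
      then show ?thesis unfolding U_def by (intro bexI[of _ "c {u, v}"]) auto
    qed
    obtain i where "i \<in> U" using many by meson
    moreover obtain j where "j \<in> U" "i \<noteq> j" using many[of i i] by auto
    moreover obtain k where "k \<in> U" "i \<noteq> k" "j \<noteq> k" using many[of i j] by auto
    ultimately have ijk: "i \<in> U" "j \<in> U" "k \<in> U" "i \<noteq> j" "i \<noteq> k" "j \<noteq> k" by auto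
    obtain l u v where l: "l \<in> {i, j, k}" "u \<in> V" "v \<in> V" "(u, v) \<notin> (color_rel c l V)\<^sup>*"
      using gallai_three_colors_disconnected[OF less.prems ijk(4-6)] by blast
    have "l \<in> U" using l ijk by auto
    then obtain x y where xy: "x \<in> V" "y \<in> V" "x \<noteq> y" "c {x, y} = l" unfolding U_def by blast
    \<comment> \<open>The color \<open>l\<close> occurs on \<open>xy\<close>, so the component
      \<open>H\<close> of \<open>x\<close> has at least two vertices; as \<open>l\<close> is
      disconnected, \<open>H\<close> is a proper subset and the induction hypothesis applies to
      it.\<close>
    define H where "H = {w \<in> V. (x, w) \<in> (color_rel c l V)\<^sup>*}"
    have "H \<noteq> V" using l(2-4) unfolding H_def
      by (metis (mono_tags, lifting) color_rel_rtrancl_sym mem_Collect_eq rtrancl_trans)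
    then have "H \<subset> V" unfolding H_def by auto
    then have cH: "card H < card V" using less.prems(1) by (simp add: psubset_card_mono)
    have finH: "finite H" unfolding H_def using less.prems(1) by simp
    have "{x, y} \<subseteq> H" using xy unfolding H_def by (auto simp: color_rel_def)
    then have "card H \<ge> 2" using xy finH by (metis card_2_iff card_mono)
    moreover have "gallai c H" using less.prems(3) \<open>H \<subset> V\<close> by (auto intro: gallai_subset)
    ultimately obtain a b where ab: "a \<in> H" "b \<in> H" "a \<noteq> b"
      "4 * card (bad_leaves c H (c {a, b}) a b) < card H"
      using less.hyps[OF cH finH] by blast
    have "c {w, a} = c {w, b}" if "w \<in> V" "w \<notin> H" for w
    proof -
      have "(a, w) \<notin> (color_rel c l V)\<^sup>*" "(a, b) \<in> (color_rel c l V)\<^sup>*"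
        using ab(1,2) that unfolding H_def by (blast intro: rtrancl_trans color_rel_rtrancl_sym)+
      then show ?thesis using component_homogeneous[OF less.prems(3) that(1)] by blast
    qed
    then have "bad_leaves c V (c {a, b}) a b = bad_leaves c H (c {a, b}) a b"
      using \<open>H \<subset> V\<close> unfolding bad_leaves_def by auto
    then show ?thesis using ab cH \<open>H \<subset> V\<close> by (metis order_less_trans psubsetD)
  qed
qed

section \<open>Sign matrices\<close>

text \<open>For signs, \<open>(1 + e) (1 - f)\<close> is 4 at the pattern \<open>e = 1\<close>,
  \<open>f = -1\<close> and 0 at the other three; its expansion is summed over
  \<open>W\<close>.\<close>

lemma card_opposite_signs:
  fixes e f :: "'a \<Rightarrow> int"
  assumes "finite W" "\<And>w. w \<in> W \<Longrightarrow> e w \<in> {1, -1}" "\<And>w. w \<in> W \<Longrightarrow> f w \<in> {1, -1}"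
  shows "4 * int (card {w \<in> W. e w = 1 \<and> f w = -1})
    = int (card W) + sum e W - sum f W - (\<Sum>w\<in>W. e w * f w)"
proof -
  have "4 * int (card {w \<in> W. e w = 1 \<and> f w = -1})
      = (\<Sum>w\<in>W. if e w = 1 \<and> f w = -1 then 4 else 0)"
    using assms(1) by (simp add: sum.If_cases Int_def)
  also have "\<dots> = (\<Sum>w\<in>W. 1 + e w - f w - e w * f w)"
    by (rule sum.cong) (use assms(2,3) in fastforce)+
  also have "\<dots> = int (card W) + sum e W - sum f W - (\<Sum>w\<in>W. e w * f w)"
    by (simp add: sum.distrib sum_subtractf)
  finally show ?thesis .
qed

section \<open>The symplectic sign matrix of order 4^k\<close>

definition sylvester4 :: "nat \<Rightarrow> nat \<Rightarrow> int" where
  "sylvester4 a b = (if a = 0 \<or> b = 0 \<or> a = b then 1 else -1)"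

text \<open>
  The Kronecker power of \<open>sylvester4\<close> is the matrix of \<open>(-1) ^ \<omega>(x, y)\<close> for the symplectic form
  \<open>\<omega>\<close> on \<open>GF(2) ^ 2k\<close>.
\<close>

fun sylvester :: "nat \<Rightarrow> nat \<Rightarrow> nat \<Rightarrow> int" where
  "sylvester 0 i j = 1"
| "sylvester (Suc k) i j = sylvester k (i div 4) (j div 4) * sylvester4 (i mod 4) (j mod 4)"

lemma sylvester_sym: "sylvester k i j = sylvester k j i"
  by (induction k arbitrary: i j) (auto simp: sylvester4_def)

lemma sylvester_diag: "sylvester k i i = 1"
  by (induction k arbitrary: i) (auto simp: sylvester4_def)

lemma sylvester_zero: "sylvester k 0 j = 1"
  by (induction k arbitrary: j) (auto simp: sylvester4_def)

lemma sylvester_sign: "sylvester k i j \<in> {1, -1}"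
proof (induction k arbitrary: i j)
  case (Suc k)
  then show ?case using Suc[of "i div 4" "j div 4"] by (auto simp: sylvester4_def)
qed simp

lemma sum_div_mod_4:
  "(\<Sum>j<4 * n. f (j div 4) (j mod 4)) = (\<Sum>m<n. \<Sum>r<4. f m r)"
  for f :: "nat \<Rightarrow> nat \<Rightarrow> 'a::comm_monoid_add"
proof (induction n)
  case (Suc n)
  have expand: "(\<Sum>j<4 * Suc n. F j) = (\<Sum>j<4 * n. F j) + F (4 * n) + F (Suc (4 * n))
      + F (Suc (Suc (4 * n))) + F (Suc (Suc (Suc (4 * n))))" for F :: "nat \<Rightarrow> 'a"
  proof -
    have "4 * Suc n = Suc (Suc (Suc (Suc (4 * n))))" by simp
    then show ?thesis by (simp only: sum.lessThan_Suc)
  qed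
  have div_mod: "4 * n div 4 = n" "4 * n mod 4 = 0" "Suc (4 * n) div 4 = n" "Suc (Suc (4 * n)) div 4 = n"
    "Suc (Suc (Suc (4 * n))) div 4 = n" "Suc (4 * n) mod 4 = 1" "Suc (Suc (4 * n)) mod 4 = 2"
    "Suc (Suc (Suc (4 * n))) mod 4 = 3"
    by presburger+
  have inner: "(\<Sum>r<4. f n r) = f n 0 + f n 1 + f n 2 + f n 3"
    by (simp add: eval_nat_numeral)
  show ?case by (simp only: expand div_mod inner Suc sum.lessThan_Suc add.assoc)
qed simp

lemma sylvester4_orthogonal:
  "a < 4 \<Longrightarrow> b < 4 \<Longrightarrow> (\<Sum>r<4. sylvester4 a r * sylvester4 b r) = (if a = b then 4 else 0)"
proof -
  assume "a < 4" "b < 4"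
  then have "a \<in> {0, 1, 2, 3}" "b \<in> {0, 1, 2, 3}" by auto
  moreover have "{..<4::nat} = {0, 1, 2, 3}" by auto
  ultimately show ?thesis by (auto simp: sylvester4_def)
qed

text \<open>The inner product of two rows of a Kronecker product is a product of inner products.
  Distinct rows differ in the last base-4 digit, where \<open>sylvester4\<close> gives the factor 0,
  or else in the remaining digits, where induction does.\<close>

lemma sylvester_orthogonal:
  assumes "i < 4 ^ k" "i' < 4 ^ k" "i \<noteq> i'"
  shows "(\<Sum>j<4 ^ k. sylvester k i j * sylvester k i' j) = 0"
  using assms
proof (induction k arbitrary: i i')
  case (Suc k)
  have "(\<Sum>j<4 ^ Suc k. sylvester (Suc k) i j * sylvester (Suc k) i' j)
      = (\<Sum>m<4 ^ k. \<Sum>r<4. sylvester k (i div 4) m * sylvester k (i' div 4) m *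
          (sylvester4 (i mod 4) r * sylvester4 (i' mod 4) r))"
    using sum_div_mod_4[of "\<lambda>m r. sylvester k (i div 4) m * sylvester k (i' div 4) m *
          (sylvester4 (i mod 4) r * sylvester4 (i' mod 4) r)" "4 ^ k"]
    by (simp add: mult_ac)
  also have "\<dots> = (\<Sum>m<4 ^ k. sylvester k (i div 4) m * sylvester k (i' div 4) m) *
      (if i mod 4 = i' mod 4 then 4 else 0)"
    using sylvester4_orthogonal[of "i mod 4" "i' mod 4"]
    by (simp add: sum_distrib_right flip: sum_distrib_left)
  also have "\<dots> = 0"
  proof (cases "i mod 4 = i' mod 4")
    case True
    then have "i div 4 \<noteq> i' div 4" using Suc.prems(3) by (metis div_mod_decomp)
    moreover have "i div 4 < 4 ^ k" "i' div 4 < 4 ^ k" using Suc.prems by auto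
    ultimately show ?thesis using Suc.IH by simp
  qed simp
  finally show ?case .
qed simp

text \<open>Row 0 is constantly 1, so orthogonality to it makes all other row sums 0, and exactly a
  quarter of the columns show the pattern \<open>(1, -1)\<close>.\<close>

lemma sylvester_opposite_signs:
  assumes k: "k \<ge> 1" and ab: "a \<in> {1..<4 ^ k}" "b \<in> {1..<4 ^ k}" "a \<noteq> b"
  shows "4 ^ (k - 1) - 1 \<le> card {w \<in> {1..<4 ^ k} - {a, b}. sylvester k a w = 1 \<and> sylvester k b w = -1}"
    (is "_ \<le> card ?B")
proof -
  let ?A = "{w \<in> {..<4 ^ k}. sylvester k a w = 1 \<and> sylvester k b w = -1}"
  have row: "(\<Sum>w<4 ^ k. sylvester k x w) = 0" if "x \<in> {1..<4 ^ k}" for x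
    using sylvester_orthogonal[of x k 0] that by (simp add: sylvester_zero)
  have "4 * int (card ?A) = int (card {..<4 ^ k :: nat}) + (\<Sum>w<4 ^ k. sylvester k a w)
      - (\<Sum>w<4 ^ k. sylvester k b w) - (\<Sum>w<4 ^ k. sylvester k a w * sylvester k b w)"
    by (rule card_opposite_signs) (auto simp only: sylvester_sign finite_lessThan)
  also have "\<dots> = 4 ^ k" using row ab sylvester_orthogonal[of a k b] by simp
  also have "\<dots> = 4 * 4 ^ (k - 1)"
    using k by (metis Suc_diff_1 less_eq_Suc_le One_nat_def power_Suc)
  finally have "int (card ?A) = int (4 ^ (k - 1))" by simp
  then have "card ?A = 4 ^ (k - 1)" by (simp only: of_nat_eq_iff)
  \<comment> \<open>Row \<open>b\<close> has the entry 1 in column 0 and in column \<open>b\<close>,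
    so neither shows the pattern. Only column \<open>a\<close> may have to be discarded, which costs
    the 1 in the bound.\<close>
  moreover have "?A - {a} \<subseteq> ?B"
    by (auto simp: sylvester_diag sylvester_zero sylvester_sym[of k _ 0] Suc_le_eq intro!: Nat.gr0I)
  then have "card (?A - {a}) \<le> card ?B" by (rule card_mono[rotated]) simp
  moreover have "card ?A - 1 \<le> card (?A - {a})" by (simp add: card_Diff_singleton_if)
  ultimately show ?thesis by simp
qed

text \<open>The linear terms of \<open>card_opposite_signs\<close> cancel: the row sums are equal,
  and since the diagonal is 0, deleting the columns \<open>a\<close> and \<open>b\<close> takes
  \<open>E a b\<close> from both. The inner product stays 0, which leaves
  \<open>card V - 2\<close>.\<close>

lemma regular_conference_opposite_signs:
  fixes E :: "'a \<Rightarrow> 'a \<Rightarrow> int"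
  assumes fin: "finite V"
    and sym: "\<And>a b. E a b = E b a" and diag: "\<And>a. a \<in> V \<Longrightarrow> E a a = 0"
    and sign: "\<And>a b. a \<in> V \<Longrightarrow> b \<in> V \<Longrightarrow> a \<noteq> b \<Longrightarrow> E a b \<in> {1, -1}"
    and regular: "\<And>a. a \<in> V \<Longrightarrow> (\<Sum>w\<in>V. E a w) = r"
    and orth: "\<And>a b. a \<in> V \<Longrightarrow> b \<in> V \<Longrightarrow> a \<noteq> b \<Longrightarrow> (\<Sum>w\<in>V. E a w * E b w) = 0"
    and ab: "a \<in> V" "b \<in> V" "a \<noteq> b"
  shows "4 * card {w \<in> V - {a, b}. E a w = 1 \<and> E b w = -1} = card V - 2"
proof -
  have split: "sum g V = g a + g b + sum g (V - {a, b})" for g :: "'a \<Rightarrow> int"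
    using sum.subset_diff[of "{a, b}" V g] fin ab by simp
  have c: "card {a, b} = 2" using ab by simp
  have "4 * int (card {w \<in> V - {a, b}. E a w = 1 \<and> E b w = -1})
    = int (card (V - {a, b})) + (\<Sum>w\<in>V - {a, b}. E a w) - (\<Sum>w\<in>V - {a, b}. E b w)
      - (\<Sum>w\<in>V - {a, b}. E a w * E b w)"
    by (rule card_opposite_signs) (use fin sign ab in auto)
  also have "(\<Sum>w\<in>V - {a, b}. E a w) = r - E a b"
    using split[of "E a"] regular[OF ab(1)] diag ab by simp
  also have "(\<Sum>w\<in>V - {a, b}. E b w) = r - E a b"
    using split[of "E b"] regular[OF ab(2)] diag ab sym[of b a] by simp
  also have "(\<Sum>w\<in>V - {a, b}. E a w * E b w) = 0"
    using split[of "\<lambda>w. E a w * E b w"] orth[OF ab] diag ab by simp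
  also have "card (V - {a, b}) = card V - 2"
    using card_Diff_subset[of "{a, b}" V] ab c by simp
  finally show ?thesis by linarith
qed

section \<open>The conference matrix of an affine plane of odd order\<close>

text \<open>
  The lines of parallel class \<open>d \<le> q\<close> are labelled by \<open>K\<close>, and \<open>cls d u\<close> is the label of the line of
  that class through the point \<open>u\<close>.
\<close>

locale odd_affine_plane =
  fixes P :: "'p set" and K :: "'k set" and cls :: "nat \<Rightarrow> 'p \<Rightarrow> 'k" and q :: nat
  assumes finite_K: "finite K" and card_K: "card K = q" and odd_q: "odd q"
    and card_P: "card P = q\<^sup>2"
    and cls_in: "d \<le> q \<Longrightarrow> u \<in> P \<Longrightarrow> cls d u \<in> K"
    and cls_inj: "d \<le> q \<Longrightarrow> d' \<le> q \<Longrightarrow> d \<noteq> d' \<Longrightarrow> inj_on (\<lambda>u. (cls d u, cls d' u)) P"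
begin

declare sum_of_bool_mult_eq [simp del] sum_mult_of_bool_eq [simp del]

lemma q_pos: "q > 0" using odd_q by (rule odd_pos)

lemma finite_P: "finite P"
  using card_P q_pos by (metis card_ge_0_finite zero_less_power)

text \<open>A pair of labels determines the point, and there are \<open>q^2\<close> points as well
  as \<open>q^2\<close> pairs; so two non-parallel classes are coordinates on the plane.\<close>

lemma sum_two_classes:
  fixes h :: "'k \<Rightarrow> 'k \<Rightarrow> int"
  assumes "d \<le> q" "d' \<le> q" "d \<noteq> d'"
  shows "(\<Sum>w\<in>P. h (cls d w) (cls d' w)) = (\<Sum>x\<in>K. \<Sum>y\<in>K. h x y)"
proof -
  let ?f = "\<lambda>u. (cls d u, cls d' u)"
  have "?f ` P \<subseteq> K \<times> K" using cls_in assms by auto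
  moreover have "card (?f ` P) = card (K \<times> K)"
    using card_image[OF cls_inj[OF assms]] card_P card_K
    by (simp add: card_cartesian_product power2_eq_square)
  ultimately have "?f ` P = K \<times> K" using finite_K by (simp add: card_subset_eq)
  then have "(\<Sum>z\<in>K \<times> K. case z of (x, y) \<Rightarrow> h x y) = (\<Sum>w\<in>P. h (cls d w) (cls d' w))"
    using sum.reindex[OF cls_inj[OF assms], of "\<lambda>(x, y). h x y"] by simp
  then show ?thesis by (simp add: sum.cartesian_product)
qed

lemma sum_line_other:
  fixes g :: "'k \<Rightarrow> int"
  assumes "d \<le> q" "d' \<le> q" "d \<noteq> d'" "u \<in> P"
  shows "(\<Sum>w\<in>P. of_bool (cls d u = cls d w) * g (cls d' w)) = sum g K"
proof -
  have "(\<Sum>x\<in>K. \<Sum>y\<in>K. of_bool (cls d u = x) * g y) = sum g K"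
    using cls_in[OF assms(1,4)] finite_K
    by (simp add: of_bool_def flip: sum_distrib_left sum_distrib_right)
  then show ?thesis
    using sum_two_classes[OF assms(1-3), of "\<lambda>x y. of_bool (cls d u = x) * g y"] by simp
qed

lemma sum_line_same:
  fixes g :: "'k \<Rightarrow> int"
  assumes "d \<le> q" "u \<in> P"
  shows "(\<Sum>w\<in>P. of_bool (cls d u = cls d w) * g (cls d w)) = int q * g (cls d u)"
proof -
  \<comment> \<open>Any second class, which exists as \<open>q >= 1\<close>, serves as an auxiliary
    coordinate that counts the \<open>q\<close> points of a line of class \<open>d\<close>.\<close>
  obtain d' where d': "d' \<le> q" "d \<noteq> d'"
    using q_pos by (metis le_eq_less_or_eq less_not_refl zero_le)
  have "(\<Sum>x\<in>K. \<Sum>y\<in>K. of_bool (cls d u = x) * g x)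
      = (\<Sum>x\<in>K. if cls d u = x then int q * g x else 0)"
    by (rule sum.cong) (auto simp: card_K)
  also have "\<dots> = int q * g (cls d u)"
    using cls_in[OF assms] finite_K by simp
  finally have "(\<Sum>x\<in>K. \<Sum>y\<in>K. of_bool (cls d u = x) * g x) = int q * g (cls d u)" .
  then show ?thesis
    using sum_two_classes[OF assms(1) d', of "\<lambda>x y. of_bool (cls d u = x) * g x"] by simp
qed

lemma sum_line:
  fixes g :: "'k \<Rightarrow> int"
  assumes "d \<le> q" "d' \<le> q" "u \<in> P"
  shows "(\<Sum>w\<in>P. of_bool (cls d u = cls d w) * g (cls d' w))
    = sum g K + of_bool (d = d') * (int q * g (cls d u) - sum g K)"
  using sum_line_other[OF assms(1,2) _ assms(3), of g] sum_line_same[OF assms(1,3), of g]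
  by (cases "d = d'") auto

text \<open>The \<open>q + 1\<close> lines through \<open>u\<close> contain \<open>q - 1\<close>
  further points each. By injectivity every other point lies on at most one of them, and since
  \<open>(q + 1) (q - 1)\<close> is the number of other points, on exactly one.\<close>

lemma common_class:
  assumes u: "u \<in> P" "v \<in> P" "u \<noteq> v"
  shows "(\<Sum>d\<le>q. of_bool (cls d u = cls d v)) = (1::int)"
proof -
  define N where "N w = (\<Sum>d\<le>q. of_bool (cls d u = cls d w) :: int)" for w
  have le: "N w \<le> 1" if w: "w \<in> P" "u \<noteq> w" for w
  proof -
    have "d = d'" if "d \<le> q" "d' \<le> q" "cls d u = cls d w" "cls d' u = cls d' w" for d d'
      using inj_onD[OF cls_inj, of d d' u w] that u w by auto
    then have "card {d \<in> {..q}. cls d u = cls d w} \<le> 1"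
      by (auto simp: card_le_Suc0_iff_eq)
    then show ?thesis by (simp add: N_def Int_def)
  qed
  have "(\<Sum>w\<in>P. N w) = (\<Sum>d\<le>q. \<Sum>w\<in>P. of_bool (cls d u = cls d w) * 1)"
    unfolding N_def by (subst sum.swap) simp
  also have "\<dots> = (\<Sum>d\<le>q. int q)"
    by (rule sum.cong) (use sum_line_same[OF _ u(1), of _ "\<lambda>_. 1"] in simp_all)
  also have "\<dots> = (int q + 1) * int q" by simp
  finally have "(\<Sum>w\<in>P. N w) = (int q + 1) * int q" .
  moreover have "N u = int q + 1" by (simp add: N_def)
  ultimately have "(\<Sum>w\<in>P - {u}. N w) = (int q + 1) * int q - (int q + 1)"
    using u finite_P by (simp add: sum_diff1)
  also have "\<dots> = int (q\<^sup>2) - 1" by (simp add: algebra_simps power2_eq_square)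
  also have "\<dots> = int (card (P - {u}))"
    using u finite_P q_pos by (simp add: card_P of_nat_diff)
  finally have "(\<Sum>w\<in>P - {u}. 1 - N w) = 0" by (simp add: sum_subtractf)
  moreover have "(\<Sum>w\<in>P - {u}. 1 - N w) = 0 \<longleftrightarrow> (\<forall>w\<in>P - {u}. 1 - N w = 0)"
    using le finite_P by (intro sum_nonneg_eq_0_iff) auto
  ultimately show ?thesis using u unfolding N_def by auto
qed

text \<open>As \<open>q\<close> is odd, exactly half of the \<open>q + 1\<close> classes get the
  sign 1.\<close>

definition class_sign :: "nat \<Rightarrow> int" where
  "class_sign d = (if d \<le> q div 2 then 1 else -1)"

lemma class_sign_square: "class_sign d * class_sign d = 1" by (simp add: class_sign_def)

lemma sum_class_sign: "(\<Sum>d\<le>q. class_sign d) = 0"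
proof -
  obtain m where m: "q = 2 * m + 1" using odd_q by (rule oddE)
  have "{..q} \<inter> {d. d \<le> q div 2} = {..m}" "{..q} \<inter> - {d. d \<le> q div 2} = {m<..q}"
    using m by auto
  note sets = this
  have "(\<Sum>d\<le>q. class_sign d)
      = int (card ({..q} \<inter> {d. d \<le> q div 2})) - int (card ({..q} \<inter> - {d. d \<le> q div 2}))"
    unfolding class_sign_def by (simp add: sum.If_cases)
  also have "\<dots> = 0" unfolding sets using m by simp
  finally show ?thesis .
qed

text \<open>For distinct points only their common class contributes, which gives the sign of the
  line joining them; on the diagonal all classes contribute and cancel. The form as a sum over
  classes gives access to \<open>sum_line\<close>.\<close>

definition conf :: "'p \<Rightarrow> 'p \<Rightarrow> int" where
  "conf u w = (\<Sum>d\<le>q. class_sign d * of_bool (cls d u = cls d w))"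

lemma conf_sym: "conf u w = conf w u"
  unfolding conf_def by (rule sum.cong) auto

lemma conf_diag: "conf u u = 0"
  by (simp add: conf_def sum_class_sign)

lemma conf_sign:
  assumes "u \<in> P" "v \<in> P" "u \<noteq> v"
  shows "conf u v \<in> {1, -1}"
proof -
  have "card {d \<in> {..q}. cls d u = cls d v} = 1"
    using common_class[OF assms] by (simp add: Int_def)
  then obtain d where d: "{d \<in> {..q}. cls d u = cls d v} = {d}" by (auto simp: card_1_singleton_iff)
  have "conf u v = sum class_sign {d \<in> {..q}. cls d u = cls d v}"
    unfolding conf_def by (simp add: of_bool_def Int_def if_distrib sum.If_cases cong: if_cong)
  then show ?thesis unfolding d by (simp add: class_sign_def)
qed

text \<open>A class other than \<open>d'\<close> contributes its sign times \<open>sum g K\<close>,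
  because each of its lines meets each line of class \<open>d'\<close> once. As the signs add up to
  0, only the deviation of class \<open>d'\<close> from that value survives.\<close>

lemma sum_conf_class:
  fixes g :: "'k \<Rightarrow> int"
  assumes "u \<in> P" "d' \<le> q"
  shows "(\<Sum>w\<in>P. conf u w * g (cls d' w)) = class_sign d' * (int q * g (cls d' u) - sum g K)"
proof -
  have "(\<Sum>w\<in>P. conf u w * g (cls d' w))
      = (\<Sum>w\<in>P. \<Sum>d\<le>q. class_sign d * (of_bool (cls d u = cls d w) * g (cls d' w)))"
    by (simp add: conf_def sum_distrib_right mult.assoc)
  also have "\<dots> = (\<Sum>d\<le>q. class_sign d * (\<Sum>w\<in>P. of_bool (cls d u = cls d w) * g (cls d' w)))"
    by (subst sum.swap) (simp add: sum_distrib_left)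
  also have "\<dots> = (\<Sum>d\<le>q. class_sign d * (sum g K + of_bool (d = d') * (int q * g (cls d u) - sum g K)))"
    by (rule sum.cong) (use sum_line assms in simp_all)
  also have "\<dots> = (\<Sum>d\<le>q. class_sign d * sum g K)
      + (\<Sum>d\<le>q. of_bool (d = d') * (class_sign d * (int q * g (cls d u) - sum g K)))"
    unfolding sum.distrib[symmetric] by (rule sum.cong) (auto simp: distrib_left mult.left_commute)
  also have "\<dots> = (\<Sum>d\<le>q. of_bool (d = d') * (class_sign d * (int q * g (cls d u) - sum g K)))"
    by (simp add: sum_class_sign flip: sum_distrib_right)
  also have "\<dots> = class_sign d' * (int q * g (cls d' u) - sum g K)"
    using assms(2) by (simp add: of_bool_def if_distrib[of "\<lambda>x. x * _"] cong: if_cong)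
  finally show ?thesis .
qed

lemma sum_conf:
  assumes "u \<in> P"
  shows "(\<Sum>w\<in>P. conf u w) = 0"
  using sum_conf_class[OF assms, of 0 "\<lambda>_. 1"] card_K by simp

text \<open>After expanding \<open>conf v w\<close>, \<open>sum_conf_class\<close> is applied to the
  indicator of each line through \<open>v\<close>, and the class signs square to 1. The common class
  contributes \<open>q - 1\<close> and each of the \<open>q\<close> others -1.\<close>

lemma conf_orthogonal:
  assumes uv: "u \<in> P" "v \<in> P" "u \<noteq> v"
  shows "(\<Sum>w\<in>P. conf u w * conf v w) = -1"
proof -
  have "(\<Sum>w\<in>P. conf u w * conf v w)
      = (\<Sum>w\<in>P. \<Sum>d\<le>q. class_sign d * (conf u w * of_bool (cls d v = cls d w)))"
    by (simp add: conf_def[of v] sum_distrib_left mult_ac)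
  also have "\<dots> = (\<Sum>d\<le>q. class_sign d * (\<Sum>w\<in>P. conf u w * of_bool (cls d v = cls d w)))"
    by (subst sum.swap) (simp add: sum_distrib_left)
  also have "\<dots> = (\<Sum>d\<le>q. int q * of_bool (cls d u = cls d v) - 1)"
  proof (rule sum.cong)
    fix d assume "d \<in> {..q}"
    then have d: "d \<le> q" by simp
    have "(\<Sum>k\<in>K. of_bool (cls d v = k)) = (1::int)"
      using cls_in[OF d uv(2)] finite_K by (simp add: of_bool_def)
    then have "(\<Sum>w\<in>P. conf u w * of_bool (cls d v = cls d w))
        = class_sign d * (int q * of_bool (cls d u = cls d v) - 1)"
      using sum_conf_class[OF uv(1) d, of "\<lambda>k. of_bool (cls d v = k)"]
      by (simp only: eq_commute[of "cls d v" "cls d u"])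
    then show "class_sign d * (\<Sum>w\<in>P. conf u w * of_bool (cls d v = cls d w))
        = int q * of_bool (cls d u = cls d v) - 1"
      using class_sign_square[of d] by (simp flip: mult.assoc)
  qed simp
  also have "\<dots> = int q * (\<Sum>d\<le>q. of_bool (cls d u = cls d v)) - (int q + 1)"
    by (simp only: sum_subtractf sum_distrib_left) simp
  also have "\<dots> = -1" by (simp only: common_class[OF uv])
  finally show ?thesis .
qed

text \<open>
  Switching at \<open>(q-1)/2\<close> lines of class 0 makes all row sums of the conference matrix (with the
  border row \<open>None\<close>) equal to \<open>q\<close>, so that two rows have equally many \<open>+-\<close> as \<open>-+\<close> columns.
\<close>

definition minus_labels :: "'k set" where "minus_labels = (SOME A. A \<subseteq> K \<and> card A = q div 2)"

lemma minus_labels: "minus_labels \<subseteq> K" "card minus_labels = q div 2"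
proof -
  have "\<exists>A. A \<subseteq> K \<and> card A = q div 2"
    using obtain_subset_with_card_n[of "q div 2" K] card_K by (metis div_le_dividend)
  then show "minus_labels \<subseteq> K" "card minus_labels = q div 2"
    unfolding minus_labels_def by (metis (mono_tags, lifting) someI_ex)+
qed

definition switch :: "'k \<Rightarrow> int" where "switch k = (if k \<in> minus_labels then -1 else 1)"

lemma switch_square: "switch k * switch k = 1" by (simp add: switch_def)

lemma sum_switch: "sum switch K = 1"
proof -
  obtain m where m: "q = 2 * m + 1" using odd_q by (rule oddE)
  have "K \<inter> minus_labels = minus_labels" using minus_labels by auto
  moreover have "card (K - minus_labels) = m + 1"
    using minus_labels m card_K finite_K by (simp add: card_Diff_subset finite_subset)
  moreover have "card minus_labels = m" using minus_labels m by simp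
  ultimately show ?thesis
    unfolding switch_def using finite_K by (simp add: sum.If_cases Diff_eq[symmetric])
qed

fun rconf :: "'p option \<Rightarrow> 'p option \<Rightarrow> int" where
  "rconf (Some u) (Some w) = switch (cls 0 u) * switch (cls 0 w) * conf u w"
| "rconf (Some u) None = switch (cls 0 u)"
| "rconf None (Some w) = switch (cls 0 w)"
| "rconf None None = 0"

definition pts :: "'p option set" where "pts = insert None (Some ` P)"

lemma finite_pts: "finite pts" and card_pts: "card pts = q\<^sup>2 + 1"
  using finite_P by (auto simp: pts_def card_image card_P)

lemma sum_pts: "(\<Sum>w\<in>pts. h w) = h None + (\<Sum>w\<in>P. h (Some w))" for h :: "'p option \<Rightarrow> int"
  using finite_P by (simp add: pts_def sum.reindex)

lemma rconf_sym: "rconf a b = rconf b a"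
  by (cases a; cases b) (auto simp: conf_sym)

lemma rconf_diag: "rconf a a = 0"
  by (cases a) (auto simp: conf_diag)

lemma rconf_sign:
  assumes "a \<in> pts" "b \<in> pts" "a \<noteq> b"
  shows "rconf a b \<in> {1, -1}"
proof -
  have s: "switch k \<in> {1, -1}" for k by (simp add: switch_def)
  consider u w where "a = Some u" "b = Some w" "u \<in> P" "w \<in> P" "u \<noteq> w"
    | u where "a = Some u" "b = None" | w where "a = None" "b = Some w"
    using assms by (auto simp: pts_def)
  then show ?thesis
  proof cases
    case 1
    then show ?thesis using conf_sign[of u w] s[of "cls 0 u"] s[of "cls 0 w"] by auto
  qed (use s in auto)
qed

text \<open>In a row \<open>Some u\<close> the points contribute
  \<open>q - switch (cls 0 u)\<close>, class 0 having the sign 1, and the border entry restores the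
  missing term. In the row \<open>None\<close> each label is used by \<open>q\<close> points and
  \<open>sum_switch\<close> applies.\<close>

lemma rconf_regular:
  assumes "a \<in> pts"
  shows "(\<Sum>w\<in>pts. rconf a w) = int q"
proof (cases a)
  case None
  have "(\<Sum>w\<in>P. switch (cls 0 w)) = (\<Sum>x\<in>K. \<Sum>y\<in>K. switch x)"
    using sum_two_classes[of 0 1 "\<lambda>x y. switch x"] q_pos by simp
  also have "\<dots> = int q" using sum_switch card_K by (simp flip: sum_distrib_left)
  finally show ?thesis using None by (simp add: sum_pts)
next
  case (Some u)
  then have u: "u \<in> P" using assms by (auto simp: pts_def)
  have "(\<Sum>w\<in>P. rconf a (Some w)) = switch (cls 0 u) * (\<Sum>w\<in>P. conf u w * switch (cls 0 w))"
    using Some by (simp add: sum_distrib_left mult_ac)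
  also have "\<dots> = switch (cls 0 u) * (int q * switch (cls 0 u) - 1)"
    using sum_conf_class[OF u, of 0 switch] by (simp add: sum_switch class_sign_def)
  also have "\<dots> = int q - switch (cls 0 u)"
    using switch_square[of "cls 0 u"] by (simp add: right_diff_distrib mult.left_commute)
  finally show ?thesis using Some by (simp add: sum_pts)
qed

text \<open>For two points the switches turn the -1 of \<open>conf_orthogonal\<close> into minus the
  product of their border entries, which the border column compensates. Against the border row the
  switches square away and \<open>sum_conf\<close> remains.\<close>

lemma rconf_orthogonal:
  assumes "a \<in> pts" "b \<in> pts" "a \<noteq> b"
  shows "(\<Sum>w\<in>pts. rconf a w * rconf b w) = 0"
proof -
  have inf: "(\<Sum>w\<in>pts. rconf (Some u) w * rconf None w) = 0" if "u \<in> P" for u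
  proof -
    have "(\<Sum>w\<in>pts. rconf (Some u) w * rconf None w)
        = (\<Sum>w\<in>P. switch (cls 0 u) * (switch (cls 0 w) * switch (cls 0 w)) * conf u w)"
      by (simp add: sum_pts mult_ac)
    then show ?thesis using sum_conf[OF that] by (simp add: switch_square flip: sum_distrib_left)
  qed
  consider u w where "a = Some u" "b = Some w" "u \<in> P" "w \<in> P" "u \<noteq> w"
    | u where "a = Some u" "b = None" "u \<in> P" | w where "a = None" "b = Some w" "w \<in> P"
    using assms by (auto simp: pts_def)
  then show ?thesis
  proof cases
    case (1 u v)
    have "(\<Sum>w\<in>P. rconf a (Some w) * rconf b (Some w))
        = (\<Sum>w\<in>P. switch (cls 0 u) * switch (cls 0 v) * (switch (cls 0 w) * switch (cls 0 w))
            * (conf u w * conf v w))"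
      using 1 by (simp add: mult_ac)
    also have "\<dots> = - (switch (cls 0 u) * switch (cls 0 v))"
      using conf_orthogonal[OF 1(3-5)] by (simp add: switch_square flip: sum_distrib_left)
    finally show ?thesis using 1 by (simp add: sum_pts)
  next
    case 2
    then show ?thesis using inf by simp
  next
    case 3
    then show ?thesis using inf by (simp add: mult.commute)
  qed
qed

lemma rconf_opposite_signs:
  assumes "a \<in> pts" "b \<in> pts" "a \<noteq> b"
  shows "4 * card {w \<in> pts - {a, b}. rconf a w = 1 \<and> rconf b w = -1} = q\<^sup>2 - 1"
  using regular_conference_opposite_signs[of pts rconf, OF finite_pts rconf_sym rconf_diag
      rconf_sign rconf_regular rconf_orthogonal assms] card_pts by simp

end

section \<open>Affine planes of prime power order\<close>

lemma (in cring) binomial_expansion: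
  assumes x: "x \<in> carrier R" and y: "y \<in> carrier R"
  shows "(x \<oplus> y) [^] n = (\<Oplus>k\<in>{..n::nat}. [(n choose k)] \<cdot> (x [^] k \<otimes> y [^] (n - k)))"
proof (induction n)
  case 0
  then show ?case using x y by simp
next
  case (Suc n)
  define t where "t k = x [^] k \<otimes> y [^] (Suc n - k)" for k
  have t: "t k \<in> carrier R" for k unfolding t_def using x y by simp
  let ?S = "\<Oplus>k\<in>{..n}. [(n choose k)] \<cdot> (x [^] k \<otimes> y [^] (n - k))"
  have S: "?S \<in> carrier R" using x y by simp
  have Sx: "?S \<otimes> x = (\<Oplus>k\<in>{..n}. [(n choose k)] \<cdot> t (Suc k))"
  proof -
    have "?S \<otimes> x = (\<Oplus>k\<in>{..n}. [(n choose k)] \<cdot> (x [^] k \<otimes> y [^] (n - k)) \<otimes> x)"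
      using x y by (simp add: finsum_ldistr)
    also have "\<dots> = (\<Oplus>k\<in>{..n}. [(n choose k)] \<cdot> t (Suc k))"
    proof (rule finsum_cong')
      fix k assume "k \<in> {..n}"
      have "x [^] k \<otimes> y [^] (n - k) \<otimes> x = t (Suc k)"
        unfolding t_def using x y by (simp add: m_ac)
      then show "[(n choose k)] \<cdot> (x [^] k \<otimes> y [^] (n - k)) \<otimes> x = [(n choose k)] \<cdot> t (Suc k)"
        using x y by (simp add: add_pow_ldistr)
    qed (use t in auto)
    finally show ?thesis .
  qed
  have Sy: "?S \<otimes> y = (\<Oplus>k\<in>{..n}. [(n choose k)] \<cdot> t k)"
  proof -
    have "?S \<otimes> y = (\<Oplus>k\<in>{..n}. [(n choose k)] \<cdot> (x [^] k \<otimes> y [^] (n - k)) \<otimes> y)"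
      using x y by (simp add: finsum_ldistr)
    also have "\<dots> = (\<Oplus>k\<in>{..n}. [(n choose k)] \<cdot> t k)"
    proof (rule finsum_cong')
      fix k assume "k \<in> {..n}"
      then have "x [^] k \<otimes> y [^] (n - k) \<otimes> y = t k"
        unfolding t_def using x y by (simp add: m_assoc Suc_diff_le)
      then show "[(n choose k)] \<cdot> (x [^] k \<otimes> y [^] (n - k)) \<otimes> y = [(n choose k)] \<cdot> t k"
        using x y by (simp add: add_pow_ldistr)
    qed (use t in auto)
    finally show ?thesis .
  qed
  have "(\<Oplus>k\<in>{..Suc n}. [(Suc n choose k)] \<cdot> t k)
      = (\<Oplus>k\<in>{..n}. [(Suc n choose Suc k)] \<cdot> t (Suc k)) \<oplus> [(Suc n choose 0)] \<cdot> t 0"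
    by (rule finsum_Suc2) (use t in auto)
  also have "(\<Oplus>k\<in>{..n}. [(Suc n choose Suc k)] \<cdot> t (Suc k))
      = (\<Oplus>k\<in>{..n}. [(n choose k)] \<cdot> t (Suc k) \<oplus> [(n choose Suc k)] \<cdot> t (Suc k))"
    by (rule finsum_cong') (use t in \<open>auto simp: add.nat_pow_mult\<close>)
  also have "\<dots> = (\<Oplus>k\<in>{..n}. [(n choose k)] \<cdot> t (Suc k)) \<oplus> (\<Oplus>k\<in>{..n}. [(n choose Suc k)] \<cdot> t (Suc k))"
    by (rule finsum_addf) (use t in auto)
  \<comment> \<open>Pascal's rule has split the sum. The shifted part together with
    \<open>t 0\<close> is a sum over \<open>{..Suc n}\<close> with the coefficients of
    \<open>n\<close>, the topmost of which is 0.\<close>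
  finally have "(\<Oplus>k\<in>{..Suc n}. [(Suc n choose k)] \<cdot> t k)
      = ?S \<otimes> x \<oplus> ((\<Oplus>k\<in>{..n}. [(n choose Suc k)] \<cdot> t (Suc k)) \<oplus> [(n choose 0)] \<cdot> t 0)"
    unfolding Sx by (subst a_assoc[symmetric]) (use t in auto)
  also have "(\<Oplus>k\<in>{..n}. [(n choose Suc k)] \<cdot> t (Suc k)) \<oplus> [(n choose 0)] \<cdot> t 0
      = (\<Oplus>k\<in>{..Suc n}. [(n choose k)] \<cdot> t k)"
    by (rule finsum_Suc2[symmetric]) (use t in auto)
  also have "\<dots> = [(n choose Suc n)] \<cdot> t (Suc n) \<oplus> (\<Oplus>k\<in>{..n}. [(n choose k)] \<cdot> t k)"
    by (rule finsum_Suc) (use t in auto)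
  also have "\<dots> = ?S \<otimes> y"
    unfolding Sy using t by (simp add: binomial_eq_0)
  finally show ?case
    unfolding t_def using S x y by (simp add: Suc r_distr del: finsum_Suc)
qed

lemma (in cring) add_pow_char_multiple:
  assumes "[(p::nat)] \<cdot> \<one> = \<zero>" "p dvd m" "z \<in> carrier R"
  shows "[(m)] \<cdot> z = \<zero>"
proof -
  obtain l where m: "m = p * l" using assms(2) by blast
  have "[(p)] \<cdot> z = [(p)] \<cdot> \<one> \<otimes> z" using assms(3) by (simp add: add_pow_ldistr)
  then have "[(p)] \<cdot> z = \<zero>" using assms by simp
  then show ?thesis unfolding m using assms(3) by (simp flip: add.nat_pow_pow)
qed

lemma (in cring) frobenius_add:
  assumes p: "prime (p::nat)" "[(p)] \<cdot> \<one> = \<zero>" and x: "x \<in> carrier R" and y: "y \<in> carrier R"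
  shows "(x \<oplus> y) [^] p = x [^] p \<oplus> y [^] p"
proof -
  obtain m where m: "p = Suc (Suc m)"
    using prime_ge_2_nat[OF p(1)] by (metis add_2_eq_Suc le_Suc_ex)
  let ?f = "\<lambda>k. [(p choose k)] \<cdot> (x [^] k \<otimes> y [^] (p - k))"
  have f: "?f k \<in> carrier R" for k using x y by simp
  \<comment> \<open>The binomial coefficients strictly between the ends are divisible by
    \<open>p\<close>.\<close>
  have mid: "?f (Suc k) = \<zero>" if "k \<in> {..m}" for k
    using dvd_choose_prime[of "Suc k" p] that p x y m
    by (intro add_pow_char_multiple[OF p(2)]) auto
  have "(x \<oplus> y) [^] p = (\<Oplus>k\<in>{..Suc (Suc m)}. ?f k)"
    using binomial_expansion[OF x y, of p] m by simp
  also have "\<dots> = ?f (Suc (Suc m)) \<oplus> (\<Oplus>k\<in>{..Suc m}. ?f k)"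
    by (rule finsum_Suc) (use f in auto)
  also have "(\<Oplus>k\<in>{..Suc m}. ?f k) = (\<Oplus>k\<in>{..m}. ?f (Suc k)) \<oplus> ?f 0"
    by (rule finsum_Suc2) (use f in auto)
  also have "(\<Oplus>k\<in>{..m}. ?f (Suc k)) = (\<Oplus>k\<in>{..m}. \<zero>)"
    by (rule finsum_cong') (use mid in auto)
  finally show ?thesis using x y m[symmetric] by (simp del: nat_pow_Suc)
qed

lemma (in cring) frobenius_power_add:
  assumes p: "prime (p::nat)" "[(p)] \<cdot> \<one> = \<zero>" and x: "x \<in> carrier R" and y: "y \<in> carrier R"
  shows "(x \<oplus> y) [^] (p ^ n) = x [^] (p ^ n) \<oplus> y [^] (p ^ n)"
proof (induction n)
  case 0
  then show ?case using x y by simp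
next
  case (Suc n)
  have "z [^] (p ^ Suc n) = (z [^] (p ^ n)) [^] p" if "z \<in> carrier R" for z
    using that by (simp add: nat_pow_pow mult.commute)
  then show ?case using Suc x y frobenius_add[OF p] by simp
qed

text \<open>
  In \<open>X = T + A\<close> with \<open>A ^ p ^ n = A\<close> the additivity of the Frobenius map turns
  \<open>X ^ p ^ n - X\<close> into \<open>T ^ p ^ n - T\<close>. For a linear polynomial \<open>T\<close> this shows that the roots
  of \<open>X ^ p ^ n - X\<close> are simple.
\<close>

lemma (in domain) square_not_divides_frobenius_minus_id:
  assumes p: "prime (p::nat)" "[(p)] \<cdot> \<one> = \<zero>" and n: "n \<ge> 1"
    and T: "T \<in> carrier R" "T \<noteq> \<zero>" "T \<notin> Units R" and A: "A \<in> carrier R" "A [^] (p ^ n) = A"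
  shows "\<not> (T [^] (2::nat)) divides ((T \<oplus> A) [^] (p ^ n) \<ominus> (T \<oplus> A))"
proof
  assume "(T [^] (2::nat)) divides ((T \<oplus> A) [^] (p ^ n) \<ominus> (T \<oplus> A))"
  then obtain h where h: "h \<in> carrier R"
    "(T \<oplus> A) [^] (p ^ n) \<ominus> (T \<oplus> A) = (T [^] (2::nat)) \<otimes> h"
    unfolding factor_def by blast
  \<comment> \<open>As \<open>p^n >= 2\<close>, the power \<open>T^(p^n)\<close> has the form
    \<open>T^2 u\<close>. Cancelling one factor \<open>T\<close> then leads to
    \<open>T (u - h) = 1\<close>.\<close>
  have "2 \<le> p" using prime_ge_2_nat[OF p(1)] .
  also have "p \<le> p ^ n" using n prime_gt_0_nat[OF p(1)] by (simp add: self_le_power Suc_leI)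
  finally obtain m where m: "p ^ n = Suc (Suc m)" by (metis add_2_eq_Suc le_Suc_ex)
  define u where "u = T [^] m"
  have u: "u \<in> carrier R" unfolding u_def using T by simp
  have Tq: "T [^] (p ^ n) = T \<otimes> (T \<otimes> u)"
    unfolding m u_def using T by (simp add: m_ac)
  have "T \<otimes> (T \<otimes> h) = (T \<otimes> (T \<otimes> u) \<oplus> A) \<ominus> (T \<oplus> A)"
    using h frobenius_power_add[OF p T(1) A(1), of n] A T by (simp add: Tq numeral_2_eq_2 m_assoc)
  also have "\<dots> = T \<otimes> (T \<otimes> u \<ominus> \<one>)"
    using T u A(1) by algebra
  finally have "T \<otimes> h = T \<otimes> u \<ominus> \<one>"
    using T(1,2) u h(1) by (simp add: m_lcancel)
  then have "T \<otimes> (u \<ominus> h) = \<one>"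
    using T(1) u h(1) by algebra
  then have "T \<in> Units R"
    using T(1) u h(1) unfolding Units_def by (auto simp: m_comm intro!: bexI[of _ "u \<ominus> h"])
  then show False using T by simp
qed

section \<open>Finite fields and their affine planes\<close>

lemma (in ring_hom_ring) hom_add_pow_one:
  "[(n::nat)] \<cdot>\<^bsub>S\<^esub> \<one>\<^bsub>S\<^esub> = h ([n] \<cdot>\<^bsub>R\<^esub> \<one>)"
  by (induction n) (simp_all add: S.add.nat_pow_Suc R.add.nat_pow_Suc)

text \<open>The polynomial \<open>X^q - X\<close> with \<open>q = p^n\<close> splits, so it has
  \<open>q\<close> roots with multiplicity. They are simple:
  \<open>square_not_divides_frobenius_minus_id\<close> applies in the polynomial ring to
  \<open>T = X - a\<close> and the constant \<open>A = a\<close>, where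
  \<open>T + A = X\<close>.\<close>

lemma (in algebraically_closed) card_frobenius_fixed:
  assumes p: "prime (p::nat)" "[p] \<cdot> \<one> = \<zero>" and n: "n \<ge> 1"
  shows "card {x \<in> carrier L. x [^] (p ^ n) = x} = p ^ n"
proof -
  define q where "q = p ^ n"
  have q: "q > 1"
    unfolding q_def using prime_gt_1_nat[OF p(1)] n by (intro one_less_power) auto
  define U where "U = poly_ring L"
  interpret U: domain U unfolding U_def using univ_poly_is_domain[OF carrier_is_subring] .
  have X: "X \<in> carrier U" unfolding U_def using var_closed(1)[OF carrier_is_subring] .
  have Xq: "X [^]\<^bsub>U\<^esub> q \<in> carrier U" using X by simp
  define P where "P = X [^]\<^bsub>U\<^esub> q \<ominus>\<^bsub>U\<^esub> X"
  have P: "P \<in> carrier U" unfolding P_def using X by simp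
  have degP: "degree P = q"
  proof -
    have "degree (X [^]\<^bsub>U\<^esub> q) = q"
      unfolding U_def unitary_monom_eq_var_pow[OF carrier_is_subring, symmetric] monom_def by simp
    moreover have "degree (\<ominus>\<^bsub>U\<^esub> X) = 1"
      using X univ_poly_a_inv_def'[OF carrier_is_subring] unfolding U_def by (simp add: var_def)
    moreover have "polynomial (carrier L) (X [^]\<^bsub>U\<^esub> q)" "polynomial (carrier L) (\<ominus>\<^bsub>U\<^esub> X)"
      using Xq X U.a_inv_closed[OF X] unfolding U_def univ_poly_carrier[symmetric] by auto
    ultimately have "degree (poly_add (X [^]\<^bsub>U\<^esub> q) (\<ominus>\<^bsub>U\<^esub> X)) = max q 1"
      using poly_add_degree_eq[OF carrier_is_subring, of "X [^]\<^bsub>U\<^esub> q" "\<ominus>\<^bsub>U\<^esub> X"] q by simp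
    then show ?thesis
      using q unfolding P_def a_minus_def U_def univ_poly_add by simp
  qed
  then have P0: "P \<noteq> []" using q by auto
  have evalP: "eval P a = a [^] q \<ominus> a" if a: "a \<in> carrier L" for a
  proof -
    interpret ev: ring_hom_ring U L "\<lambda>p. eval p a"
      unfolding U_def using eval_ring_hom[OF carrier_is_subring a] .
    show ?thesis
      unfolding P_def a_minus_def using X Xq
      by (simp add: ev.hom_nat_pow eval_var[OF a])
  qed
  have root: "is_root P a \<longleftrightarrow> a \<in> carrier L \<and> a [^] q = a" for a
    unfolding is_root_def using P0 evalP by auto
  have charU: "[p] \<cdot>\<^bsub>U\<^esub> \<one>\<^bsub>U\<^esub> = \<zero>\<^bsub>U\<^esub>"
  proof -
    interpret co: ring_hom_ring L U poly_of_const
      unfolding U_def using canonical_embedding_ring_hom[OF carrier_is_subring] by simp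
    show ?thesis using co.hom_add_pow_one[of p] p(2) by simp
  qed
  have mult: "alg_mult P a \<le> 1" if a: "a \<in> carrier L" "a [^] q = a" for a
  proof (rule ccontr)
    assume "\<not> alg_mult P a \<le> 1"
    then have div: "([\<one>, \<ominus> a] [^]\<^bsub>U\<^esub> (2::nat)) divides\<^bsub>U\<^esub> P"
      using le_alg_mult_imp_pdivides[OF a(1), of P 2] P unfolding U_def pdivides_def by simp
    define A where "A = poly_of_const a"
    interpret co: ring_hom_ring L U poly_of_const
      unfolding U_def using canonical_embedding_ring_hom[OF carrier_is_subring] by simp
    have A: "A \<in> carrier U" "A [^]\<^bsub>U\<^esub> q = A"
      unfolding A_def using a co.hom_nat_pow[OF a(1), of q] by auto
    have T: "[\<one>, \<ominus> a] \<in> carrier U" 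
      unfolding U_def univ_poly_carrier[symmetric] polynomial_def using a by auto
    have "[\<one>, \<ominus> a] \<oplus>\<^bsub>U\<^esub> A = X"
      unfolding U_def univ_poly_add A_def poly_of_const_def var_def using a by (auto simp: l_neg)
    \<comment> \<open>Evaluation at \<open>a\<close> would keep a unit invertible, but it sends
      \<open>X - a\<close> to 0.\<close>
    moreover have "[\<one>, \<ominus> a] \<notin> Units U"
    proof
      assume "[\<one>, \<ominus> a] \<in> Units U"
      then obtain g where g: "g \<in> carrier U" "[\<one>, \<ominus> a] \<otimes>\<^bsub>U\<^esub> g = \<one>\<^bsub>U\<^esub>"
        by (meson U.Units_r_inv_ex)
      interpret ev: ring_hom_ring U L "\<lambda>p. eval p a"
        unfolding U_def using eval_ring_hom[OF carrier_is_subring a(1)] .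
      have "eval [\<one>, \<ominus> a] a \<otimes> eval g a = \<one>"
        using ev.hom_mult[OF T g(1)] g(2) ev.hom_one by simp
      moreover have "eval [\<one>, \<ominus> a] a = \<zero>" using a by (simp add: r_neg)
      moreover have "eval g a \<in> carrier L" using g(1) by (rule ev.hom_closed)
      ultimately show False by simp
    qed
    moreover have "[\<one>, \<ominus> a] \<noteq> \<zero>\<^bsub>U\<^esub>" unfolding U_def univ_poly_zero by simp
    ultimately show False
      using U.square_not_divides_frobenius_minus_id[OF p(1) charU n T _ _ A(1)] A(2) div
      unfolding q_def P_def by simp
  qed
  have "size (roots P) = q"
    using roots_over_carrier[of P] P degP unfolding U_def splitted_def by simp
  moreover have "set_mset (roots P) = {x \<in> carrier L. x [^] q = x}"
    using roots_mem_iff_is_root[of P] P root unfolding U_def by auto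
  moreover have "count (roots P) a = 1" if "a \<in># roots P" for a
    using mult[of a] root[of a] roots_mem_iff_is_root[of P a] alg_mult_eq_count_roots[of P] P that
      count_greater_zero_iff[of "roots P" a]
    unfolding U_def by (metis One_nat_def Suc_leI le_antisym)
  then have "size (roots P) = card (set_mset (roots P))"
    by (simp add: size_multiset_overloaded_eq)
  ultimately show ?thesis unfolding q_def by simp
qed

text \<open>The element type of the algebraic closure that \<open>exists_closure\<close> yields for
  the integers modulo \<open>p\<close>.\<close>

type_synonym closure_elem = "(int list \<times> nat) multiset \<Rightarrow> int"

text \<open>\<open>F\<close> is the set of fixed points of the \<open>p^n\<close>-th power in the
  algebraic closure of the integers modulo \<open>p\<close>; additivity of the Frobenius map closes
  it under sums. Subtraction and cancellation are later done in \<open>L\<close>.\<close>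

lemma exists_finite_subring_prime_power:
  assumes p: "prime (p::nat)" and n: "n \<ge> 1"
  obtains L :: "closure_elem ring" and F
  where "domain L" "F \<subseteq> carrier L" "card F = p ^ n"
    "\<And>x y. x \<in> F \<Longrightarrow> y \<in> F \<Longrightarrow> x \<oplus>\<^bsub>L\<^esub> y \<in> F" "\<And>x y. x \<in> F \<Longrightarrow> y \<in> F \<Longrightarrow> x \<otimes>\<^bsub>L\<^esub> y \<in> F"
proof -
  define R where "R = residue_ring (int p)"
  interpret res: residues_prime p R
    by unfold_locales (use p in \<open>simp_all add: R_def\<close>)
  obtain L :: "closure_elem ring"
    where L: "algebraic_closure L (ring.indexed_const R ` carrier R)" "ring.indexed_const R \<in> ring_hom R L"
    using res.exists_closure by blast
  interpret L: algebraic_closure L "ring.indexed_const R ` carrier R" by (rule L(1))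
  interpret h: ring_hom_ring R L "ring.indexed_const R"
    using L(2) by (intro ring_hom_ringI2) (auto intro: res.ring_axioms L.ring_axioms)
  have "[k] \<cdot>\<^bsub>R\<^esub> \<one>\<^bsub>R\<^esub> = int k mod int p" for k :: nat
  proof (induction k)
    case 0
    then show ?case by (simp add: res.res_zero_eq)
  next
    case (Suc k)
    then show ?case
      by (simp add: res.add.nat_pow_Suc res.res_add_eq res.res_one_eq mod_add_left_eq mod_add_right_eq add.commute)
  qed
  then have "[p] \<cdot>\<^bsub>R\<^esub> \<one>\<^bsub>R\<^esub> = \<zero>\<^bsub>R\<^esub>" by (simp add: res.res_zero_eq)
  then have char: "[p] \<cdot>\<^bsub>L\<^esub> \<one>\<^bsub>L\<^esub> = \<zero>\<^bsub>L\<^esub>" using h.hom_add_pow_one[of p] by simp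
  let ?F = "{x \<in> carrier L. x [^]\<^bsub>L\<^esub> (p ^ n) = x}"
  show ?thesis
  proof (rule that[of L ?F])
    show "card ?F = p ^ n" by (rule L.card_frobenius_fixed[OF p char n])
  qed (use L.domain_axioms L.frobenius_power_add[OF p char] L.nat_pow_distrib in auto)
qed

text \<open>In the plane \<open>F \<times> F\<close> a class consists of the lines on which
  \<open>y + s x\<close> is constant. Two such values determine the point, because the nonzero
  difference of the slopes cancels in the domain \<open>L\<close>; the vertical class fixes
  \<open>x\<close>, and any slope then fixes \<open>y\<close>.\<close>

lemma exists_orthogonal_classes:
  assumes "primepow q"
  obtains P :: "(closure_elem \<times> closure_elem) set"
    and K :: "closure_elem set" and cls
  where "finite K" "card K = q" "card P = q\<^sup>2"
    "\<And>d u. d \<le> q \<Longrightarrow> u \<in> P \<Longrightarrow> cls d u \<in> K"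
    "\<And>d d'. d \<le> q \<Longrightarrow> d' \<le> q \<Longrightarrow> d \<noteq> d' \<Longrightarrow> inj_on (\<lambda>u. (cls d u, cls d' u)) P"
proof -
  obtain p n where p: "prime p" "n > 0" "q = p ^ n"
    using assms unfolding primepow_def by blast
  have "n \<ge> 1" using p by simp
  obtain L :: "closure_elem ring" and F
    where L: "domain L" and F: "F \<subseteq> carrier L" "card F = p ^ n"
    and add: "\<And>x y. x \<in> F \<Longrightarrow> y \<in> F \<Longrightarrow> x \<oplus>\<^bsub>L\<^esub> y \<in> F"
    and mult: "\<And>x y. x \<in> F \<Longrightarrow> y \<in> F \<Longrightarrow> x \<otimes>\<^bsub>L\<^esub> y \<in> F"
    using exists_finite_subring_prime_power[OF p(1) \<open>n \<ge> 1\<close>] by metis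
  interpret L: domain L by (rule L)
  have finF: "finite F" using F p(3) assms primepow_gt_0_nat[of q] by (metis card_ge_0_finite)
  then obtain s where s: "bij_betw s {..<q} F"
    using ex_bij_betw_nat_finite[OF finF] F(2) p(3) by (auto simp: lessThan_atLeast0)
  \<comment> \<open>Slopes \<open>d < q\<close> are enumerated by \<open>s\<close>; class \<open>q\<close> consists of the vertical lines.\<close>
  define cls where "cls d u = (if d < q then snd u \<oplus>\<^bsub>L\<^esub> s d \<otimes>\<^bsub>L\<^esub> fst u else fst u)" for d u
  have sF: "s d \<in> F" if "d < q" for d using s that by (auto dest: bij_betwE)
  have slope: "x = x' \<and> y = y'"
    if d: "d < q" "d' < q" "d \<noteq> d'" and xy: "x \<in> F" "y \<in> F" "x' \<in> F" "y' \<in> F"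
      and e: "y \<oplus>\<^bsub>L\<^esub> s d \<otimes>\<^bsub>L\<^esub> x = y' \<oplus>\<^bsub>L\<^esub> s d \<otimes>\<^bsub>L\<^esub> x'"
        "y \<oplus>\<^bsub>L\<^esub> s d' \<otimes>\<^bsub>L\<^esub> x = y' \<oplus>\<^bsub>L\<^esub> s d' \<otimes>\<^bsub>L\<^esub> x'" for d d' x y x' y'
  proof -
    have c: "x \<in> carrier L" "y \<in> carrier L" "x' \<in> carrier L" "y' \<in> carrier L"
      "s d \<in> carrier L" "s d' \<in> carrier L"
      using xy sF d F(1) by auto
    have "s d \<noteq> s d'" using s d by (auto simp: bij_betw_def inj_on_def)
    then have ne: "s d \<ominus>\<^bsub>L\<^esub> s d' \<noteq> \<zero>\<^bsub>L\<^esub>" using c by simp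
    have "(s d \<ominus>\<^bsub>L\<^esub> s d') \<otimes>\<^bsub>L\<^esub> (x \<ominus>\<^bsub>L\<^esub> x')
        = ((y \<oplus>\<^bsub>L\<^esub> s d \<otimes>\<^bsub>L\<^esub> x) \<ominus>\<^bsub>L\<^esub> (y' \<oplus>\<^bsub>L\<^esub> s d \<otimes>\<^bsub>L\<^esub> x'))
          \<ominus>\<^bsub>L\<^esub> ((y \<oplus>\<^bsub>L\<^esub> s d' \<otimes>\<^bsub>L\<^esub> x) \<ominus>\<^bsub>L\<^esub> (y' \<oplus>\<^bsub>L\<^esub> s d' \<otimes>\<^bsub>L\<^esub> x'))"
      using c by algebra
    also have "\<dots> = \<zero>\<^bsub>L\<^esub>" unfolding e using c by algebra
    finally have "x \<ominus>\<^bsub>L\<^esub> x' = \<zero>\<^bsub>L\<^esub>" using ne c by (simp add: L.integral_iff)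
    then have "x = x'" using c by simp
    then show ?thesis using e(1) c by simp
  qed
  show ?thesis
  proof (rule that[of F "F \<times> F" cls])
    show "card (F \<times> F) = q\<^sup>2" using F p by (simp add: card_cartesian_product power2_eq_square)
    show "cls d u \<in> F" if "u \<in> F \<times> F" for d u
      using that add mult sF unfolding cls_def by auto
    show "inj_on (\<lambda>u. (cls d u, cls d' u)) (F \<times> F)" if "d \<le> q" "d' \<le> q" "d \<noteq> d'" for d d'
    proof (rule inj_onI)
      fix u v assume uv: "u \<in> F \<times> F" "v \<in> F \<times> F" "(cls d u, cls d' u) = (cls d v, cls d' v)"
      obtain x y x' y' where xy: "u = (x, y)" "v = (x', y')" "x \<in> F" "y \<in> F" "x' \<in> F" "y' \<in> F"
        using uv by auto
      have c: "x \<in> carrier L" "y \<in> carrier L" "x' \<in> carrier L" "y' \<in> carrier L"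
        using xy F(1) by auto
      have sd: "s e \<in> carrier L" if "e < q" for e using sF[OF that] F(1) by auto
      consider "d < q" "d' < q" | "d = q" "d' < q" | "d < q" "d' = q"
        using \<open>d \<le> q\<close> \<open>d' \<le> q\<close> \<open>d \<noteq> d'\<close> by linarith
      then show "u = v"
      proof cases
        case 1
        then show ?thesis using slope[OF 1 \<open>d \<noteq> d'\<close> xy(3-6)] uv(3) xy(1,2) by (simp add: cls_def)
      next
        case 2
        then show ?thesis using uv(3) xy(1,2) c sd[of d'] by (auto simp: cls_def)
      next
        case 3
        then show ?thesis using uv(3) xy(1,2) c sd[of d] by (auto simp: cls_def)
      qed
    qed
  qed (use finF F p in auto)
qed

section \<open>Orderable copies of complete bipartite graphs\<close>

text \<open>Let \<open>\<alpha>\<close> be the list color of whichever of \<open>a\<close> and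
  \<open>b\<close> comes first. A leaf before that vertex has its own list color on both edges; a
  leaf after it has \<open>\<alpha>\<close> on the edge to it.\<close>

lemma orderable_imp_good_leaves:
  assumes ord: "orderable H \<chi>" and ab: "a \<in> verts H" "b \<in> verts H" "a \<noteq> b"
    and T: "T \<subseteq> verts H" "\<And>w. w \<in> T \<Longrightarrow> {w, a} \<in> edges H \<and> {w, b} \<in> edges H \<and> w \<noteq> a \<and> w \<noteq> b"
  shows "\<exists>\<alpha>. (\<forall>w\<in>T. \<chi> {w, a} = \<chi> {w, b} \<or> \<chi> {w, a} = \<alpha>)
    \<or> (\<forall>w\<in>T. \<chi> {w, b} = \<chi> {w, a} \<or> \<chi> {w, b} = \<alpha>)"
proof -
  obtain vs cs where vs: "distinct vs" "set vs = verts H"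
    and cs: "\<And>i j. i < j \<Longrightarrow> j < length vs \<Longrightarrow> {vs ! i, vs ! j} \<in> edges H \<Longrightarrow> \<chi> {vs ! i, vs ! j} = cs ! i"
    using ord unfolding orderable_def by blast
  have first: "\<chi> {w, x} = \<chi> {w, y} \<or> \<chi> {w, x} = cs ! i"
    if hyp: "i < j" "j < length vs" "x = vs ! i" "y = vs ! j" "w \<in> verts H" "w \<noteq> x"
      "{w, x} \<in> edges H" "{w, y} \<in> edges H" for i j x y w
  proof -
    obtain k where k: "k < length vs" "w = vs ! k"
      using hyp(5) vs(2) by (metis in_set_conv_nth)
    then have "k \<noteq> i" using hyp by auto
    then consider "k < i" | "i < k" by linarith
    then show ?thesis
    proof cases
      case 1
      then show ?thesis using cs[of k i] cs[of k j] hyp k by simp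
    next
      case 2
      then show ?thesis using cs[of i k] hyp k by (simp add: insert_commute)
    qed
  qed
  obtain i j where ij: "i < length vs" "j < length vs" "a = vs ! i" "b = vs ! j"
    using ab vs(2) by (metis in_set_conv_nth)
  then have "i \<noteq> j" using ab by auto
  then consider "i < j" | "j < i" by linarith
  then show ?thesis
  proof cases
    case 1
    then have "\<forall>w\<in>T. \<chi> {w, a} = \<chi> {w, b} \<or> \<chi> {w, a} = cs ! i"
      using first[OF 1 ij(2-4)] T by blast
    then show ?thesis by blast
  next
    case 2
    then have "\<forall>w\<in>T. \<chi> {w, b} = \<chi> {w, a} \<or> \<chi> {w, b} = cs ! j"
      using first[OF 2 ij(1,4,3)] T by blast
    then show ?thesis by blast
  qed
qed

lemma orderable_copy_imp_good_leaves:
  assumes "has_orderable_copy (complete_bipartite 2 t) (complete_graph m) \<chi>"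
  obtains a b \<alpha> T where "a < m" "b < m" "a \<noteq> b" "T \<subseteq> {..<m} - {a, b}" "card T = t"
    "\<And>w. w \<in> T \<Longrightarrow> \<chi> {w, a} = \<chi> {w, b} \<or> \<chi> {w, a} = \<alpha>"
proof -
  obtain H where H: "subgraph_of H (complete_graph m)" "isomorphic (complete_bipartite 2 t) H"
    "orderable H \<chi>"
    using assms unfolding has_orderable_copy_def by blast
  obtain \<phi> where \<phi>: "bij_betw \<phi> ({..<2::nat} <+> {..<t}) (verts H)"
    "edges H = image \<phi> ` {{Inl i, Inr j} | i j. i < (2::nat) \<and> j < t}"
    using H(2) unfolding isomorphic_def complete_bipartite_def by auto
  have VH: "verts H \<subseteq> {..<m}"
    using H(1) unfolding subgraph_of_def complete_graph_def by simp
  have inj: "\<phi> x \<noteq> \<phi> y" if "x \<in> {..<2} <+> {..<t}" "y \<in> {..<2} <+> {..<t}" "x \<noteq> y" for x y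
    using \<phi>(1) that by (auto simp: bij_betw_def inj_on_def)
  have mem: "\<phi> x \<in> verts H" if "x \<in> {..<2} <+> {..<t}" for x
    using \<phi>(1) that by (rule bij_betwE[rule_format])
  define a b T where "a = \<phi> (Inl 0)" and "b = \<phi> (Inl 1)" and "T = \<phi> ` Inr ` {..<t}"
  have ab: "a \<in> verts H" "b \<in> verts H" "a \<noteq> b"
    unfolding a_def b_def using mem inj by (auto simp: Plus_def)
  have T: "T \<subseteq> verts H" unfolding T_def using mem by (auto simp: Plus_def)
  have cT: "card T = t"
  proof -
    have "inj_on \<phi> (Inr ` {..<t})"
      using \<phi>(1) by (auto simp: bij_betw_def simp: Plus_def intro: inj_on_subset)
    then show ?thesis unfolding T_def by (simp add: card_image)
  qed
  have edge: "{w, a} \<in> edges H \<and> {w, b} \<in> edges H \<and> w \<noteq> a \<and> w \<noteq> b" if w: "w \<in> T" for w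
  proof -
    obtain j where j: "j < t" "w = \<phi> (Inr j)" using w unfolding T_def by auto
    have "\<phi> ` {Inl i, Inr j} \<in> edges H" if "i < 2" for i
      unfolding \<phi>(2) using that j(1) by blast
    from this[of 0] this[of 1] have "{w, a} \<in> edges H" "{w, b} \<in> edges H"
      unfolding a_def b_def j(2) by (simp_all add: insert_commute)
    moreover have "w \<noteq> a" "w \<noteq> b"
      unfolding a_def b_def j(2) using inj j(1) by (auto simp: Plus_def)
    ultimately show ?thesis by simp
  qed
  have sub: "T \<subseteq> {..<m} - {a, b}" "T \<subseteq> {..<m} - {b, a}" using T VH edge by auto
  have lt: "a < m" "b < m" using ab VH by auto
  obtain \<alpha> where "(\<forall>w\<in>T. \<chi> {w, a} = \<chi> {w, b} \<or> \<chi> {w, a} = \<alpha>)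
      \<or> (\<forall>w\<in>T. \<chi> {w, b} = \<chi> {w, a} \<or> \<chi> {w, b} = \<alpha>)"
    using orderable_imp_good_leaves[OF H(3) ab T edge] by blast
  then show thesis
  proof
    assume "\<forall>w\<in>T. \<chi> {w, a} = \<chi> {w, b} \<or> \<chi> {w, a} = \<alpha>"
    then show thesis using that[OF lt ab(3) sub(1) cT] by blast
  next
    assume "\<forall>w\<in>T. \<chi> {w, b} = \<chi> {w, a} \<or> \<chi> {w, b} = \<alpha>"
    then show thesis using that[OF lt(2,1) ab(3)[symmetric] sub(2) cT] by blast
  qed
qed

lemma good_leaves_imp_orderable_copy:
  assumes ab: "a < n" "b < n" "a \<noteq> b" and T: "T \<subseteq> {..<n} - {a, b}" "card T = t"
    and good: "\<And>w. w \<in> T \<Longrightarrow> \<chi> {w, a} = \<chi> {w, b} \<or> \<chi> {w, a} = \<alpha>"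
  shows "has_orderable_copy (complete_bipartite 2 t) (complete_graph n) \<chi>"
proof -
  have finT: "finite T" using T(1) by (meson finite_Diff finite_lessThan finite_subset)
  define H where "H = \<lparr>verts = {a, b} \<union> T, edges = {{x, w} | x w. x \<in> {a, b} \<and> w \<in> T}\<rparr>"
  have edges: "edges H \<subseteq> nsets (verts H) 2"
    unfolding H_def nsets_def using T by (auto simp: card_insert_if)
  have "subgraph_of H (complete_graph n)"
  proof -
    have V: "verts H \<subseteq> {..<n}" unfolding H_def using ab T by auto
    then have "nsets (verts H) 2 \<subseteq> nsets {..<n} 2" by (rule nsets_mono)
    with V edges finT show ?thesis
      unfolding subgraph_of_def simple_graph_def complete_graph_def by (auto simp: H_def)
  qed
  moreover have "isomorphic (complete_bipartite 2 t) H"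
  proof -
    obtain f where f: "bij_betw f {..<t} T"
      using ex_bij_betw_nat_finite[OF finT] T(2) by (auto simp: lessThan_atLeast0)
    define \<phi> where "\<phi> = case_sum (\<lambda>i::nat. if i = 0 then a else b) f"
    have two: "{..<2::nat} = {0, 1}" by auto
    have "bij_betw \<phi> ({..<2} <+> {..<t}) ({a, b} \<union> T)"
      unfolding bij_betw_def
    proof
      show "inj_on \<phi> ({..<2} <+> {..<t})"
      proof -
        have "f j \<noteq> a" "f j \<noteq> b" if "j < t" for j
          using that f T(1) by (auto simp: bij_betw_def)
        moreover have "i = j" if "i < t" "j < t" "f i = f j" for i j
          using that f by (auto simp: bij_betw_def inj_on_def)
        ultimately show ?thesis
          using ab(3) unfolding \<phi>_def two by (auto simp: inj_on_def) blast+
      qed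
      show "\<phi> ` ({..<2} <+> {..<t}) = {a, b} \<union> T"
        using f unfolding \<phi>_def two bij_betw_def Plus_def image_Un image_image by auto
    qed
    moreover have "{{x, w} | x w. x \<in> {a, b} \<and> w \<in> T} = image \<phi> ` {{Inl i, Inr j} | i j. i < (2::nat) \<and> j < t}"
      (is "?L = ?R")
    proof
      show "?L \<subseteq> ?R"
      proof
        fix e assume "e \<in> ?L"
        then obtain x w where e: "e = {x, w}" "x \<in> {a, b}" "w \<in> T" by blast
        obtain i where i: "i < (2::nat)" "x = (if i = 0 then a else b)"
          using e(2) that[of 0] that[of 1] by auto
        obtain j where j: "j < t" "w = f j" using e(3) f by (auto simp: bij_betw_def)
        have "e = \<phi> ` {Inl i, Inr j}" unfolding e i(2) j(2) \<phi>_def by simp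
        then show "e \<in> ?R" using i(1) j(1) by blast
      qed
      show "?R \<subseteq> ?L"
      proof
        fix e assume "e \<in> ?R"
        then obtain i j where ij: "e = \<phi> ` {Inl i, Inr j}" "i < 2" "j < t" by blast
        then have "e = {if i = 0 then a else b, f j}" by (simp add: \<phi>_def)
        moreover have "f j \<in> T" using f ij(3) by (auto simp: bij_betw_def)
        ultimately show "e \<in> ?L" by auto
      qed
    qed
    ultimately show ?thesis
      unfolding isomorphic_def complete_bipartite_def H_def by auto
  qed
  moreover have "orderable H \<chi>"
  proof -
    define A where "A = {w \<in> T. \<chi> {w, a} = \<chi> {w, b}}"
    obtain xs where xs: "set xs = A" "distinct xs"
      using finite_distinct_list[of A] finT unfolding A_def by auto
    obtain ys where ys: "set ys = T - A" "distinct ys"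
      using finite_distinct_list[of "T - A"] finT by auto
    define vs where "vs = xs @ a # ys @ [b]"
    \<comment> \<open>The list colors: \<open>\<alpha>\<close> for \<open>a\<close>, and for a leaf
      the color of its edge to \<open>b\<close>, the last vertex, which \<open>butlast\<close>
      removes below.\<close>
    define F where "F v = (if v = a then \<alpha> else \<chi> {v, b})" for v
    have AT: "A \<subseteq> T" unfolding A_def by auto
    have vs: "distinct vs" "set vs = verts H"
      using xs ys ab T AT unfolding vs_def H_def by auto
    let ?P = "\<lambda>x y. {x, y} \<in> edges H \<longrightarrow> \<chi> {x, y} = F x"
    have no_edge: "{x, y} \<notin> edges H" if "x \<in> T" "y \<in> T" for x y
      using that T(1) unfolding H_def by (auto simp: doubleton_eq_iff)
    have indep: "sorted_wrt ?P zs" if "set zs \<subseteq> T" for zs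
      using that by (induction zs) (use no_edge in auto)
    have ab_edge: "{a, b} \<notin> edges H"
      using T(1) unfolding H_def by (auto simp: doubleton_eq_iff)
    have F: "\<chi> {w, b} = F w" if "w \<in> T" for w
      using that T(1) unfolding F_def by auto
    have xs_F: "\<chi> {w, a} = F w" if "w \<in> A" for w
      using that F AT unfolding A_def by auto
    have ys_F: "\<chi> {a, w} = F a" if "w \<in> T" "w \<notin> A" for w
      using that good[of w] unfolding A_def F_def by (simp add: insert_commute)
    have "sorted_wrt ?P vs"
      using indep[of xs] indep[of ys] no_edge ab_edge xs(1) ys(1) AT F xs_F ys_F
      unfolding vs_def by (auto simp: sorted_wrt_append)
    then have P: "?P (vs ! i) (vs ! j)" if "i < j" "j < length vs" for i j
      using that by (rule sorted_wrt_nth_less)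
    define cs where "cs = map F (butlast vs)"
    have "length cs = card (verts H) - 1"
      unfolding cs_def using distinct_card[OF vs(1)] vs(2) by simp
    moreover have "\<chi> {vs ! i, vs ! j} = cs ! i"
      if "i < j" "j < length vs" "{vs ! i, vs ! j} \<in> edges H" for i j
      using P[OF that(1,2)] that unfolding cs_def by (simp add: nth_butlast)
    ultimately show ?thesis unfolding orderable_def using vs by blast
  qed
  ultimately show ?thesis unfolding has_orderable_copy_def by blast
qed

text \<open>Fewer than \<open>n/4\<close>, hence at most \<open>n - 2 - t\<close>, of the
  \<open>n - 2\<close> leaves are bad, so at least \<open>t\<close> good ones remain.\<close>

lemma gallai_imp_orderable_copy:
  assumes "gallai \<chi> {..<n}" and n: "n \<ge> 2" "n \<le> 4 * (n - 1 - t)"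
  shows "has_orderable_copy (complete_bipartite 2 t) (complete_graph n) \<chi>"
proof -
  obtain a b where ab: "a \<in> {..<n}" "b \<in> {..<n}" "a \<noteq> b"
    "4 * card (bad_leaves \<chi> {..<n} (\<chi> {a, b}) a b) < card {..<n}"
    using gallai_few_bad_leaves[of "{..<n}" \<chi>] assms by auto
  define B where "B = bad_leaves \<chi> {..<n} (\<chi> {a, b}) a b"
  have "B \<subseteq> {..<n} - {a, b}" unfolding B_def bad_leaves_def by auto
  then have "card ({..<n} - {a, b} - B) = card ({..<n} - {a, b}) - card B"
    by (meson card_Diff_subset finite_Diff finite_lessThan finite_subset)
  also have "card ({..<n} - {a, b}) = n - 2"
    using ab by (simp add: card_Diff_subset)
  finally have "t \<le> card ({..<n} - {a, b} - B)" using ab(4) n unfolding B_def by simp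
  then obtain T where T: "T \<subseteq> {..<n} - {a, b} - B" "card T = t"
    by (meson obtain_subset_with_card_n)
  show ?thesis
    by (rule good_leaves_imp_orderable_copy[of a n b T t \<chi> "\<chi> {a, b}"])
      (use ab T in \<open>auto simp: B_def bad_leaves_def\<close>)
qed

section \<open>Rainbow triangles and the two Ramsey numbers\<close>

lemma edges_complete_graph_3: "edges (complete_graph 3) = {{0, 1}, {0, 2}, {1, 2}}"
proof -
  have "{..<3::nat} = {0, 1, 2}" by auto
  moreover have "{0, 1, 2} - {0} = {1, 2::nat}" "{0, 1, 2} - {1} = {0, 2::nat}"
    "{0, 1, 2} - {2} = {0, 1::nat}" by auto
  ultimately have "edges (complete_graph 3) = {{0, 1}, {0, 2}, {1, 0}, {1, 2}, {2, 0}, {2, 1}}"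
    by (simp only: complete_graph_def nsets_2_eq graph.simps) auto
  then show ?thesis by (simp add: insert_commute)
qed

lemma no_rainbow_triangle_imp_gallai:
  assumes "\<not> has_rainbow_copy (complete_graph 3) (complete_graph n) \<chi>"
  shows "gallai \<chi> {..<n}"
  unfolding gallai_def
proof (intro ballI impI, rule ccontr)
  fix u v w assume uvw: "u \<in> {..<n}" "v \<in> {..<n}" "w \<in> {..<n}" "u \<noteq> v" "u \<noteq> w" "v \<noteq> w"
    and "\<not> (\<chi> {u, v} = \<chi> {u, w} \<or> \<chi> {u, v} = \<chi> {v, w} \<or> \<chi> {u, w} = \<chi> {v, w})"
  then have ne: "\<chi> {u, v} \<noteq> \<chi> {u, w}" "\<chi> {u, v} \<noteq> \<chi> {v, w}" "\<chi> {u, w} \<noteq> \<chi> {v, w}" by auto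
  define H where "H = \<lparr>verts = {u, v, w}, edges = {{u, v}, {u, w}, {v, w}}\<rparr>"
  have V: "verts H \<subseteq> {..<n}" unfolding H_def using uvw by auto
  have E: "edges H \<subseteq> nsets (verts H) 2" unfolding H_def nsets_def using uvw by auto
  have "nsets (verts H) 2 \<subseteq> nsets {..<n} 2" using V by (rule nsets_mono)
  then have "subgraph_of H (complete_graph n)"
    using V E unfolding subgraph_of_def simple_graph_def complete_graph_def by (auto simp: H_def)
  moreover have "isomorphic (complete_graph 3) H"
  proof -
    define \<phi> where "\<phi> i = (if i = 0 then u else if i = 1 then v else w)" for i :: nat
    have "verts (complete_graph 3) = {0, 1, 2}" by (auto simp: complete_graph_def)
    then have "bij_betw \<phi> (verts (complete_graph 3)) (verts H)"
      unfolding bij_betw_def \<phi>_def H_def using uvw by (auto simp: inj_on_def)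
    moreover have "edges H = image \<phi> ` edges (complete_graph 3)"
      unfolding edges_complete_graph_3 \<phi>_def H_def by (auto simp: insert_commute)
    ultimately show ?thesis unfolding isomorphic_def by blast
  qed
  moreover have "rainbow H \<chi>"
    unfolding rainbow_def H_def using ne by (auto simp: inj_on_def)
  ultimately show False using assms unfolding has_rainbow_copy_def by blast
qed

lemma two_colors_no_rainbow_triangle:
  assumes "\<And>e. \<chi> e \<in> {0, 1::nat}"
  shows "\<not> has_rainbow_copy (complete_graph 3) (complete_graph m) \<chi>"
proof
  assume "has_rainbow_copy (complete_graph 3) (complete_graph m) \<chi>"
  then obtain H where H: "isomorphic (complete_graph 3) H" and r: "inj_on \<chi> (edges H)"
    unfolding has_rainbow_copy_def rainbow_def by blast
  obtain \<phi> where \<phi>: "bij_betw \<phi> (verts (complete_graph 3)) (verts H)"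
    "edges H = image \<phi> ` edges (complete_graph 3)"
    using H unfolding isomorphic_def by blast
  have "\<phi> 0 \<noteq> \<phi> 1" "\<phi> 0 \<noteq> \<phi> 2" "\<phi> 1 \<noteq> \<phi> 2"
  proof -
    have inj: "inj_on \<phi> {..<3}" using \<phi>(1) by (simp add: bij_betw_def complete_graph_def)
    show "\<phi> 0 \<noteq> \<phi> 1" "\<phi> 0 \<noteq> \<phi> 2" "\<phi> 1 \<noteq> \<phi> 2"
      using inj_onD[OF inj, of 0 1] inj_onD[OF inj, of 0 2] inj_onD[OF inj, of 1 2] by auto
  qed
  moreover have "edges H = {{\<phi> 0, \<phi> 1}, {\<phi> 0, \<phi> 2}, {\<phi> 1, \<phi> 2}}"
    unfolding \<phi>(2) edges_complete_graph_3 by simp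
  ultimately have "card (edges H) = 3" by (auto simp: doubleton_eq_iff)
  then have "card (\<chi> ` edges H) = 3" using card_image[OF r] by simp
  moreover have "card (\<chi> ` edges H) \<le> card {0, 1::nat}"
  proof (rule card_mono)
    show "\<chi> ` edges H \<subseteq> {0, 1}" by (rule image_subsetI) (rule assms)
  qed simp
  ultimately show False by simp
qed

text \<open>The coloring \<open>c\<close> of \<open>n - 1\<close> vertices gives the lower bound:
  for each pair and each \<open>\<alpha>\<close> at least \<open>s\<close> of the
  \<open>n - 3\<close> leaves are bad, and fewer than \<open>t\<close> remain.\<close>

lemma ramsey_numbers_eqI:
  fixes c :: "nat set \<Rightarrow> nat"
  assumes n: "n \<ge> 2" "n \<le> 4 * (n - 1 - t)" and s: "n \<le> s + t + 2"
    and two: "\<And>e. c e \<in> {0, 1}"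
    and many: "\<And>a b. a < n - 1 \<Longrightarrow> b < n - 1 \<Longrightarrow> a \<noteq> b \<Longrightarrow>
      s \<le> card {w \<in> {..<n - 1} - {a, b}. c {w, a} = 0 \<and> c {w, b} = 1}"
  shows "orderable_ramsey2 (complete_bipartite 2 t) = n
    \<and> CR (complete_bipartite 2 t) (complete_graph 3) = n"
proof -
  have upper: "has_orderable_copy (complete_bipartite 2 t) (complete_graph n) \<chi>
      \<or> has_rainbow_copy (complete_graph 3) (complete_graph n) \<chi>" for \<chi> :: "nat set \<Rightarrow> nat"
    using gallai_imp_orderable_copy[OF no_rainbow_triangle_imp_gallai n] by blast
  have lower: "\<not> has_orderable_copy (complete_bipartite 2 t) (complete_graph m) c" if m: "m < n" for m
  proof
    assume "has_orderable_copy (complete_bipartite 2 t) (complete_graph m) c"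
    then obtain a b \<alpha> T where ab: "a < m" "b < m" "a \<noteq> b" and T: "T \<subseteq> {..<m} - {a, b}" "card T = t"
      and good: "\<And>w. w \<in> T \<Longrightarrow> c {w, a} = c {w, b} \<or> c {w, a} = \<alpha>"
      by (rule orderable_copy_imp_good_leaves) blast
    define W where "W = {..<n - 1} - {a, b}"
    have cW: "card W = n - 3" unfolding W_def using ab m by (simp add: card_Diff_subset)
    \<comment> \<open>A leaf violates \<open>good\<close> if it sees \<open>a\<close> and
      \<open>b\<close> in different colors and \<open>a\<close> not in color
      \<open>\<alpha>\<close>: the pattern is \<open>(1, 0)\<close> for \<open>\<alpha> = 0\<close>
      and \<open>(0, 1)\<close> otherwise.\<close>
    have "\<exists>S \<subseteq> W. s \<le> card S \<and> S \<inter> T = {}"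
    proof (cases "\<alpha> = 0")
      case True
      then show ?thesis
        using many[of b a] ab m good unfolding W_def
        by (intro exI[of _ "{w \<in> {..<n - 1} - {b, a}. c {w, b} = 0 \<and> c {w, a} = 1}"]) force
    next
      case False
      then show ?thesis
        using many[of a b] ab m good unfolding W_def
        by (intro exI[of _ "{w \<in> {..<n - 1} - {a, b}. c {w, a} = 0 \<and> c {w, b} = 1}"]) force
    qed
    then obtain S where S: "S \<subseteq> W" "s \<le> card S" "S \<inter> T = {}" by blast
    have "T \<subseteq> W" using T m unfolding W_def by auto
    moreover have "finite W" unfolding W_def by simp
    ultimately have "card S + card T \<le> card W"
      using S by (metis Un_least card_Un_disjoint card_mono finite_subset)
    moreover have "n \<ge> 3" using ab m by linarith
    ultimately show False using S T cW s by linarith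
  qed
  have "orderable_ramsey2 (complete_bipartite 2 t) = n"
    unfolding orderable_ramsey2_def
  proof (rule cInf_eq_minimum)
    have "has_orderable_copy (complete_bipartite 2 t) (complete_graph n) \<chi>"
      if \<chi>: "\<chi> \<in> edges (complete_graph n) \<rightarrow> {0, 1}" for \<chi> :: "nat set \<Rightarrow> nat"
    proof -
      have "\<chi> {u, v} \<in> {0, 1}" if "u < n" "v < n" "u \<noteq> v" for u v
        using \<chi> that by (force simp: complete_graph_def nsets_2_eq)
      then have "gallai \<chi> {..<n}" unfolding gallai_def by (metis insertE lessThan_iff singletonD)
      then show ?thesis using n by (rule gallai_imp_orderable_copy)
    qed
    then show "n \<in> {n. \<forall>\<chi> :: nat set \<Rightarrow> nat. \<chi> \<in> edges (complete_graph n) \<rightarrow> {0, 1} \<longrightarrow>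
        has_orderable_copy (complete_bipartite 2 t) (complete_graph n) \<chi>}" by blast
  next
    fix m assume "m \<in> {n. \<forall>\<chi> :: nat set \<Rightarrow> nat. \<chi> \<in> edges (complete_graph n) \<rightarrow> {0, 1} \<longrightarrow>
        has_orderable_copy (complete_bipartite 2 t) (complete_graph n) \<chi>}"
    moreover have "c \<in> edges (complete_graph m) \<rightarrow> {0, 1}" using two by (rule Pi_I)
    ultimately have "has_orderable_copy (complete_bipartite 2 t) (complete_graph m) c" by simp
    then show "n \<le> m" using lower[of m] by linarith
  qed
  moreover have "CR (complete_bipartite 2 t) (complete_graph 3) = n"
    unfolding CR_def
  proof (rule cInf_eq_minimum)
    fix m assume "m \<in> {n. \<forall>\<chi> :: nat set \<Rightarrow> nat.
        has_orderable_copy (complete_bipartite 2 t) (complete_graph n) \<chi>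
        \<or> has_rainbow_copy (complete_graph 3) (complete_graph n) \<chi>}"
    then have "has_orderable_copy (complete_bipartite 2 t) (complete_graph m) c"
      using two_colors_no_rainbow_triangle[of c m, OF two] by blast
    then show "n \<le> m" using lower[of m] by linarith
  qed (use upper in blast)
  ultimately show ?thesis by blast
qed

lemma sign_matrix_imp_coloring:
  fixes E :: "'a \<Rightarrow> 'a \<Rightarrow> int"
  assumes fin: "finite V" and sym: "\<And>x y. E x y = E y x"
    and many: "\<And>x y. x \<in> V \<Longrightarrow> y \<in> V \<Longrightarrow> x \<noteq> y \<Longrightarrow>
      s \<le> card {w \<in> V - {x, y}. E x w = 1 \<and> E y w = -1}"
  obtains c :: "nat set \<Rightarrow> nat" where "\<And>e. c e \<in> {0, 1}"
    "\<And>a b. a < card V \<Longrightarrow> b < card V \<Longrightarrow> a \<noteq> b \<Longrightarrow>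
      s \<le> card {w \<in> {..<card V} - {a, b}. c {w, a} = 0 \<and> c {w, b} = 1}"
proof -
  obtain h where h: "bij_betw h {..<card V} V"
    using ex_bij_betw_nat_finite[OF fin] by (auto simp: lessThan_atLeast0)
  \<comment> \<open>Colors are assigned to sets, so the entry is read off through some naming of the
    edge; symmetry of \<open>E\<close> makes the choice immaterial.\<close>
  define c :: "nat set \<Rightarrow> nat" where
    "c e = (if \<exists>u v. e = {u, v} \<and> E (h u) (h v) = 1 then 0 else 1)" for e
  have c: "c {u, v} = (if E (h v) (h u) = 1 then 0 else 1)" for u v
  proof -
    have "(\<exists>u' v'. {u, v} = {u', v'} \<and> E (h u') (h v') = 1) \<longleftrightarrow> E (h v) (h u) = 1"
      using sym[of "h v" "h u"] by (auto simp: doubleton_eq_iff)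
    then show ?thesis unfolding c_def by simp
  qed
  show thesis
  proof (rule that[of c])
    show "c e \<in> {0, 1}" for e unfolding c_def by simp
    fix a b assume ab: "a < card V" "b < card V" "a \<noteq> b"
    have inj: "inj_on h {..<card V}" and img: "h ` {..<card V} = V"
      using h by (auto simp: bij_betw_def)
    have hab: "h a \<in> V" "h b \<in> V" "h a \<noteq> h b"
      using ab img inj_onD[OF inj, of a b] by auto
    let ?S = "{w \<in> {..<card V} - {a, b}. c {w, a} = 0 \<and> c {w, b} = 1}"
    have "{w \<in> V - {h a, h b}. E (h a) w = 1 \<and> E (h b) w = -1} \<subseteq> h ` ?S"
    proof
      fix w assume w: "w \<in> {w \<in> V - {h a, h b}. E (h a) w = 1 \<and> E (h b) w = -1}"
      then obtain i where "i < card V" "w = h i" using img by auto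
      then show "w \<in> h ` ?S" using w by (auto simp: c)
    qed
    then have "card {w \<in> V - {h a, h b}. E (h a) w = 1 \<and> E (h b) w = -1} \<le> card (h ` ?S)"
      by (rule card_mono[rotated]) simp
    also have "\<dots> \<le> card ?S" by (rule card_image_le) simp
    finally show "s \<le> card ?S" using many[OF hab] by linarith
  qed
qed

lemma ramsey_numbers_power_of_4:
  assumes k: "k \<ge> 1"
  shows "orderable_ramsey2 (complete_bipartite 2 (3 * 4 ^ (k - 1) - 1)) = 4 ^ k
    \<and> CR (complete_bipartite 2 (3 * 4 ^ (k - 1) - 1)) (complete_graph 3) = 4 ^ k"
proof -
  define m :: nat where "m = 4 ^ (k - 1)"
  have n: "4 ^ k = 4 * m" unfolding m_def
    using k by (metis Suc_diff_1 less_eq_Suc_le One_nat_def power_Suc)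
  have m: "m \<ge> 1" unfolding m_def by simp
  have "card {1..<4 ^ k :: nat} = 4 ^ k - 1" by simp
  then obtain c :: "nat set \<Rightarrow> nat" where c: "\<And>e. c e \<in> {0, 1}"
    "\<And>a b. a < 4 ^ k - 1 \<Longrightarrow> b < 4 ^ k - 1 \<Longrightarrow> a \<noteq> b \<Longrightarrow>
      m - 1 \<le> card {w \<in> {..<4 ^ k - 1} - {a, b}. c {w, a} = 0 \<and> c {w, b} = 1}"
    using sign_matrix_imp_coloring[of "{1..<4 ^ k}" "sylvester k" "m - 1",
        OF _ sylvester_sym sylvester_opposite_signs[OF k, folded m_def]] by auto
  \<comment> \<open>With \<open>n = 4 m\<close>, \<open>t = 3 m - 1\<close> and
    \<open>s = m - 1\<close>, both \<open>n = 4 (n - 1 - t)\<close> and \<open>n = s + t + 2\<close>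
    hold.\<close>
  show ?thesis
    unfolding m_def[symmetric]
    by (rule ramsey_numbers_eqI[of _ _ "m - 1" c]) (use c m n in auto)
qed

lemma ramsey_numbers_odd_prime_power:
  assumes "primepow q" "odd q"
  shows "orderable_ramsey2 (complete_bipartite 2 ((3 * q\<^sup>2 + 1) div 4)) = q\<^sup>2 + 2
    \<and> CR (complete_bipartite 2 ((3 * q\<^sup>2 + 1) div 4)) (complete_graph 3) = q\<^sup>2 + 2"
proof -
  obtain P :: "(closure_elem \<times> closure_elem) set"
    and K :: "closure_elem set" and cls
    where plane: "finite K" "card K = q" "card P = q\<^sup>2"
    "\<And>d u. d \<le> q \<Longrightarrow> u \<in> P \<Longrightarrow> cls d u \<in> K"
    "\<And>d d'. d \<le> q \<Longrightarrow> d' \<le> q \<Longrightarrow> d \<noteq> d' \<Longrightarrow> inj_on (\<lambda>u. (cls d u, cls d' u)) P"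
    by (rule exists_orthogonal_classes[OF assms(1)]) blast
  interpret odd_affine_plane P K cls q
    by (intro odd_affine_plane.intro plane assms(2))
  obtain m where "q = 2 * m + 1" using assms(2) by (rule oddE)
  then have "q\<^sup>2 = 4 * (m\<^sup>2 + m) + 1" by (simp add: power2_eq_square algebra_simps)
  then obtain r where r: "q\<^sup>2 = 4 * r + 1" by blast
  have cnt: "r \<le> card {w \<in> pts - {x, y}. rconf x w = 1 \<and> rconf y w = -1}"
    if "x \<in> pts" "y \<in> pts" "x \<noteq> y" for x y
    using rconf_opposite_signs[OF that] r by simp
  obtain c :: "nat set \<Rightarrow> nat" where c: "\<And>e. c e \<in> {0, 1}"
    "\<And>a b. a < card pts \<Longrightarrow> b < card pts \<Longrightarrow> a \<noteq> b \<Longrightarrow>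
      r \<le> card {w \<in> {..<card pts} - {a, b}. c {w, a} = 0 \<and> c {w, b} = 1}"
    by (rule sign_matrix_imp_coloring[OF finite_pts rconf_sym], erule (2) cnt) (rule that)
  have t: "(3 * q\<^sup>2 + 1) div 4 = 3 * r + 1" unfolding r by simp
  \<comment> \<open>With \<open>n = 4 r + 3\<close>, \<open>t = 3 r + 1\<close> and
    \<open>s = r\<close>, one has \<open>4 (n - 1 - t) = n + 1\<close> and
    \<open>n = s + t + 2\<close>; the matrix has order \<open>n - 1 = q^2 + 1\<close>.\<close>
  show ?thesis
    unfolding t by (rule ramsey_numbers_eqI[of _ _ r c]) (use c[unfolded card_pts] r in auto)
qed

theorem corollary1p12:
  shows "(\<forall>k::nat. k \<ge> 1 \<longrightarrow>
            orderable_ramsey2 (complete_bipartite 2 (3 * 4 ^ (k - 1) - 1)) = 4 ^ k \<and>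
            CR (complete_bipartite 2 (3 * 4 ^ (k - 1) - 1)) (complete_graph 3) = 4 ^ k) \<and>
         (\<forall>q::nat. primepow q \<and> odd q \<longrightarrow>
            orderable_ramsey2 (complete_bipartite 2 ((3 * q ^ 2 + 1) div 4)) = q ^ 2 + 2 \<and>
            CR (complete_bipartite 2 ((3 * q ^ 2 + 1) div 4)) (complete_graph 3) = q ^ 2 + 2)"
  using ramsey_numbers_power_of_4 ramsey_numbers_odd_prime_power by blast

end
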